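(* Let $X(s,\omega)$, $s\in\mathbb{R}$, be a symmetric stable process of index $2$, let $f\in L^1(\mathbb{R})\cap L^2(\mathbb{R})$, let $\lambda_k=e^{-ik\pi/2}$, and let $$a_k=\int_{-\infty}^{\infty}f(t)\psi_k(t)\,dt,\qquad A_k(\omega)=\int_{-\infty}^{\infty}\psi_k(t)\,dX(t,\omega),\qquad k\in\mathbb{N}_0,$$ where $\psi_k$ are the normalized Hermite functions. Then for every $t\in\mathbb{R}$ the series $$\sum_{k=0}^{\infty}a_k\lambda_kA_k(\omega)\psi_k(t)$$ converges in the mean (i.e. in $L^1(\Omega)$) to the stochastic integral $\int_{-\infty}^{\infty}\mathcal{F}(f(s,t))\,dX(s,\omega)$, where $\mathcal{F}(f(s,t))=\sum_{k=0}^{\infty}a_k\lambda_k\psi_k(s)\psi_k(t)$ (sum of the series in $L^2(\mathbb{R})$ in the variable $s$).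
   Context: $\mathbb{N}_0=\{0,1,2,\dots\}$. The normalized Hermite functions are $\psi_n(t)=\frac{1}{\sqrt{2^n n!\sqrt{\pi}}}H_n(t)e^{-t^2/2}$, $t\in\mathbb{R}$, where $H_n(t)=(-1)^n e^{t^2}\frac{d^n}{dt^n}e^{-t^2}$; in the paper's convention they are eigenfunctions of the Fourier transform operator $\mathcal{F}$ with eigenvalues $\lambda_n=e^{-in\pi/2}$, and $\mathcal{F}(f(s,t))$ arises from $f(s,t)=\sum_k a_k\psi_k(s)\psi_k(t)$ by replacing $\psi_k(t)$ with $\lambda_k\psi_k(t)$. A symmetric stable process of index $2$ is a real-valued process $X(t,\omega)$, $t\in\mathbb{R}$, with independent increments such that $E\,e^{iu(X(t)-X(s))}=\exp(-c|t-s||u|^{2})$ for all $s,t,u\in\mathbb{R}$, where $c>0$ is a constant. For a bounded interval $[a,b]$ and $h\in L^{2}[a,b]$, the stochastic integral $\int_a^b h\,dX$ is the $L^1(\Omega)$ limit of the integrals of step functions converging to $h$ in $L^{2}[a,b]$ (the integral of $\sum_j c_j\chi_{(t_j,t_{j+1}]}$ being $\sum_j c_j(X(t_{j+1})-X(t_j))$), and $\int_{-\infty}^{\infty}h\,dX$ is the $L^1(\Omega)$ limit of $\int_{-n}^n h\,dX$ as $n\to\infty$ (complex-valued $h$ by linearity). *)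

theory Defs
  imports "HOL-Probability.Probability"
begin

definition hermite_H :: "nat \<Rightarrow> real \<Rightarrow> real" where
  "hermite_H n t = (-1) ^ n * exp (t\<^sup>2) * (deriv ^^ n) (\<lambda>x. exp (- x\<^sup>2)) t"

definition hermite_psi :: "nat \<Rightarrow> real \<Rightarrow> real" where
  "hermite_psi n t = 1 / sqrt (2 ^ n * fact n * sqrt pi) * hermite_H n t * exp (- t\<^sup>2 / 2)"

definition fourier_eigenvalue :: "nat \<Rightarrow> complex" where
  "fourier_eigenvalue n = exp (- \<i> * of_nat n * of_real pi / 2)"


definition square_integrable_on ::
    "real set \<Rightarrow> (real \<Rightarrow> 'b::{banach, second_countable_topology}) \<Rightarrow> bool" where
  "square_integrable_on S h \<longleftrightarrow>
     set_borel_measurable lebesgue S h \<and> set_integrable lebesgue S (\<lambda>x. (norm (h x))\<^sup>2)"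

definition L2_converges_on ::
    "real set \<Rightarrow> (nat \<Rightarrow> real \<Rightarrow> 'b::{banach, second_countable_topology}) \<Rightarrow> (real \<Rightarrow> 'b) \<Rightarrow> bool" where
  "L2_converges_on S g h \<longleftrightarrow>
     (\<forall>n. square_integrable_on S (g n)) \<and> square_integrable_on S h \<and>
     (\<lambda>n. LINT x:S|lebesgue. (norm (g n x - h x))\<^sup>2) \<longlonglongrightarrow> 0"

definition converges_in_mean ::
    "'a measure \<Rightarrow> (nat \<Rightarrow> 'a \<Rightarrow> 'b::{banach, second_countable_topology}) \<Rightarrow> ('a \<Rightarrow> 'b) \<Rightarrow> bool" where
  "converges_in_mean M Y Z \<longleftrightarrow>
     (\<forall>n. integrable M (Y n)) \<and> integrable M Z \<and>
     (\<lambda>n. LINT \<omega>|M. norm (Y n \<omega> - Z \<omega>)) \<longlonglongrightarrow> 0"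


definition symmetric_stable_process_2 :: "'a measure \<Rightarrow> (real \<Rightarrow> 'a \<Rightarrow> real) \<Rightarrow> bool" where
  "symmetric_stable_process_2 M X \<longleftrightarrow>
     prob_space M \<and>
     (\<forall>t. X t \<in> borel_measurable M) \<and>
     (\<forall>(n::nat) (\<tau>::nat \<Rightarrow> real). (\<forall>j<n. \<tau> j < \<tau> (Suc j)) \<longrightarrow>
        prob_space.indep_vars M (\<lambda>_. borel) (\<lambda>j \<omega>. X (\<tau> (Suc j)) \<omega> - X (\<tau> j) \<omega>) {..<n}) \<and>
     (\<exists>c>0. \<forall>s t u. (LINT \<omega>|M. exp (\<i> * of_real (u * (X t \<omega> - X s \<omega>)))) =
        complex_of_real (exp (- c * \<bar>t - s\<bar> * \<bar>u\<bar> ^ 2)))"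


type_synonym step_data = "nat \<times> (nat \<Rightarrow> real) \<times> (nat \<Rightarrow> real)"

text \<open>
  A triple \<open>(m, \<tau>, c)\<close> encodes the step function with value \<open>c j\<close> on \<open>(\<tau> j, \<tau> (j + 1)]\<close>
  for \<open>j < m\<close> and \<open>0\<close> elsewhere.
\<close>

definition step_data_on :: "real \<Rightarrow> real \<Rightarrow> step_data \<Rightarrow> bool" where
  "step_data_on a b = (\<lambda>(m, \<tau>, c). a \<le> \<tau> 0 \<and> \<tau> m \<le> b \<and> (\<forall>j<m. \<tau> j < \<tau> (Suc j)))"

definition step_function :: "step_data \<Rightarrow> real \<Rightarrow> real" where
  "step_function = (\<lambda>(m, \<tau>, c) s. \<Sum>j<m. c j * indicator {\<tau> j<..\<tau> (Suc j)} s)"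

definition step_stoch_integral :: "(real \<Rightarrow> 'a \<Rightarrow> real) \<Rightarrow> step_data \<Rightarrow> 'a \<Rightarrow> real" where
  "step_stoch_integral X = (\<lambda>(m, \<tau>, c) \<omega>. \<Sum>j<m. c j * (X (\<tau> (Suc j)) \<omega> - X (\<tau> j) \<omega>))"

definition step_approximates ::
    "real \<Rightarrow> real \<Rightarrow> (nat \<Rightarrow> step_data) \<Rightarrow> (real \<Rightarrow> real) \<Rightarrow> bool" where
  "step_approximates a b \<phi> h \<longleftrightarrow>
     (\<forall>n. step_data_on a b (\<phi> n)) \<and> L2_converges_on {a..b} (\<lambda>n. step_function (\<phi> n)) h"

text \<open>
  The limit is required to be the same for every approximating sequence; an approximating
  sequence is required to exist, so that the condition on all of them is never vacuous.
\<close>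

definition has_stoch_integral_on ::
    "'a measure \<Rightarrow> (real \<Rightarrow> 'a \<Rightarrow> real) \<Rightarrow> real \<Rightarrow> real \<Rightarrow> (real \<Rightarrow> real) \<Rightarrow> ('a \<Rightarrow> real) \<Rightarrow> bool" where
  "has_stoch_integral_on M X a b h I \<longleftrightarrow>
     (\<exists>\<phi>. step_approximates a b \<phi> h) \<and>
     (\<forall>\<phi>. step_approximates a b \<phi> h \<longrightarrow>
        converges_in_mean M (\<lambda>n. step_stoch_integral X (\<phi> n)) I)"

definition has_stoch_integral ::
    "'a measure \<Rightarrow> (real \<Rightarrow> 'a \<Rightarrow> real) \<Rightarrow> (real \<Rightarrow> real) \<Rightarrow> ('a \<Rightarrow> real) \<Rightarrow> bool" where
  "has_stoch_integral M X h I \<longleftrightarrow>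
     (\<exists>J. (\<forall>n. has_stoch_integral_on M X (- real n) (real n) h (J n)) \<and> converges_in_mean M J I)"

definition stoch_integrable ::
    "'a measure \<Rightarrow> (real \<Rightarrow> 'a \<Rightarrow> real) \<Rightarrow> (real \<Rightarrow> real) \<Rightarrow> bool" where
  "stoch_integrable M X h \<longleftrightarrow> (\<exists>I. has_stoch_integral M X h I)"

text \<open>The stochastic integral is determined only almost surely; \<open>SOME\<close> picks a version.\<close>

definition stoch_integral ::
    "'a measure \<Rightarrow> (real \<Rightarrow> 'a \<Rightarrow> real) \<Rightarrow> (real \<Rightarrow> real) \<Rightarrow> 'a \<Rightarrow> real" where
  "stoch_integral M X h = (SOME I. has_stoch_integral M X h I)"

definition complex_stoch_integrable ::
    "'a measure \<Rightarrow> (real \<Rightarrow> 'a \<Rightarrow> real) \<Rightarrow> (real \<Rightarrow> complex) \<Rightarrow> bool" where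
  "complex_stoch_integrable M X h \<longleftrightarrow>
     stoch_integrable M X (\<lambda>s. Re (h s)) \<and> stoch_integrable M X (\<lambda>s. Im (h s))"

definition complex_stoch_integral ::
    "'a measure \<Rightarrow> (real \<Rightarrow> 'a \<Rightarrow> real) \<Rightarrow> (real \<Rightarrow> complex) \<Rightarrow> 'a \<Rightarrow> complex" where
  "complex_stoch_integral M X h \<omega> =
     of_real (stoch_integral M X (\<lambda>s. Re (h s)) \<omega>) +
     \<i> * of_real (stoch_integral M X (\<lambda>s. Im (h s)) \<omega>)"


definition hermite_coeff :: "(real \<Rightarrow> complex) \<Rightarrow> nat \<Rightarrow> complex" where
  "hermite_coeff f k = (LINT t|lebesgue. f t * of_real (hermite_psi k t))"

text \<open>
  For fixed \<open>t\<close>, the transform of the kernel \<open>f(s,t)\<close> is an element of \<open>L\<^sup>2(\<real>)\<close> in the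
  variable \<open>s\<close>, so it is described up to a.e. equality: \<open>F\<close> is any of its representatives.
\<close>

definition is_kernel_fourier_transform ::
    "(real \<Rightarrow> complex) \<Rightarrow> real \<Rightarrow> (real \<Rightarrow> complex) \<Rightarrow> bool" where
  "is_kernel_fourier_transform f t F \<longleftrightarrow>
     L2_converges_on UNIV
       (\<lambda>n s. \<Sum>k<n. hermite_coeff f k * fourier_eigenvalue k *
                of_real (hermite_psi k s) * of_real (hermite_psi k t)) F"

end

theory Submission
  imports Defs "HOL-Computational_Algebra.Polynomial"
begin

text \<open>
  The stochastic integral is, up to a constant factor, an isometry from \<open>L\<^sup>2(\<real>)\<close> into
  \<open>L\<^sup>2(\<Omega>)\<close>, so it carries a series that converges in \<open>L\<^sup>2(\<real>)\<close> term by term to a series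
  that converges in \<open>L\<^sup>2(\<Omega>)\<close>, and on a probability space that implies convergence in the mean.

  For the isometry, the characteristic function shows that \<open>X(t) - X(s)\<close> is centred normal with
  variance \<open>2 c |t - s|\<close>. By polarization the covariance of two increments, over overlapping
  intervals as well, is \<open>2 c\<close> times the length of the intersection
  (\<open>increment_covariance\<close>), i.e. the \<open>L\<^sup>2(\<real>)\<close> inner product of the two indicator functions.
  The relation \<open>wiener_integral\<close> is the closed linear hull of the pairs (indicator function of an
  interval, increment), and the identity of inner products passes to linear combinations and limits
  (\<open>wiener_integral_inner\<close>). It remains to identify this relation with the integral obtained from
  step functions on \<open>[-n, n]\<close> and \<open>n \<rightarrow> \<infinity>\<close>. That is possible for all functions that step functions
  approximate in \<open>L\<^sup>2[-n, n]\<close> for every \<open>n\<close>: among them are the Hermite functions, which are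
  continuous, and every \<open>L\<^sup>2\<close> limit of their linear combinations
  (\<open>stoch_integral_wiener_integral\<close>).

  For the convergence of the series of the transformed kernel in \<open>L\<^sup>2(\<real>)\<close> it suffices, the Hermite
  functions being orthonormal, that the coefficients \<open>a\<^sub>k \<lambda>\<^sub>k \<psi>\<^sub>k(t)\<close> are square summable in
  \<open>k\<close>. Bessel's inequality gives this for \<open>a\<^sub>k\<close>, the \<open>\<lambda>\<^sub>k\<close> have modulus one, and for fixed \<open>t\<close>
  the values \<open>\<psi>\<^sub>k(t)\<close> are bounded in \<open>k\<close> (\<open>hermite_psi_bounded\<close>), because the energy
  \<open>(2 k + 1 - t\<^sup>2) \<psi>\<^sub>k(t)\<^sup>2 + \<psi>\<^sub>k'(t)\<^sup>2\<close> of the Hermite differential equation is largest at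
  \<open>t = 0\<close>, where it is \<open>O(k)\<close>.
\<close>

section \<open>Real square integrable functions\<close>

definition L2_fun :: "'a measure \<Rightarrow> ('a \<Rightarrow> real) \<Rightarrow> bool" where
  "L2_fun N f \<longleftrightarrow> f \<in> borel_measurable N \<and> integrable N (\<lambda>x. (f x)\<^sup>2)"

definition L2_tendsto :: "'a measure \<Rightarrow> (nat \<Rightarrow> 'a \<Rightarrow> real) \<Rightarrow> ('a \<Rightarrow> real) \<Rightarrow> bool" where
  "L2_tendsto N f g \<longleftrightarrow> (\<forall>n. L2_fun N (f n)) \<and> L2_fun N g \<and>
     (\<lambda>n. \<integral>x. (f n x - g x)\<^sup>2 \<partial>N) \<longlonglongrightarrow> 0"

lemma L2_fun_measurable [measurable_dest]: "L2_fun N f \<Longrightarrow> f \<in> borel_measurable N"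
  by (simp add: L2_fun_def)

lemma L2_fun_integrable_mult:
  assumes "L2_fun N f" "L2_fun N g"
  shows "integrable N (\<lambda>x. f x * g x)"
proof (rule Bochner_Integration.integrable_bound)
  show "integrable N (\<lambda>x. (f x)\<^sup>2 + (g x)\<^sup>2)"
    using assms by (simp add: L2_fun_def)
  show "(\<lambda>x. f x * g x) \<in> borel_measurable N"
    using assms by measurable
  have "\<bar>a * b\<bar> \<le> a\<^sup>2 + b\<^sup>2" for a b :: real
  proof -
    have "2 * \<bar>a\<bar> * \<bar>b\<bar> \<le> \<bar>a\<bar>\<^sup>2 + \<bar>b\<bar>\<^sup>2" by (rule sum_squares_bound)
    moreover have "0 \<le> \<bar>a\<bar> * \<bar>b\<bar>" by simp
    ultimately show ?thesis unfolding abs_mult power2_abs by linarith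
  qed
  then show "AE x in N. norm (f x * g x) \<le> norm ((f x)\<^sup>2 + (g x)\<^sup>2)"
    by simp
qed

lemma L2_fun_lincomb:
  assumes "L2_fun N f" "L2_fun N g"
  shows "L2_fun N (\<lambda>x. f x + c * g x)"
proof -
  have "integrable N (\<lambda>x. (f x)\<^sup>2 + 2 * c * (f x * g x) + c\<^sup>2 * (g x)\<^sup>2)"
    using assms L2_fun_integrable_mult[OF assms] by (simp add: L2_fun_def)
  also have "(\<lambda>x. (f x)\<^sup>2 + 2 * c * (f x * g x) + c\<^sup>2 * (g x)\<^sup>2) = (\<lambda>x. (f x + c * g x)\<^sup>2)"
    by (simp add: fun_eq_iff power2_eq_square algebra_simps)
  finally have "integrable N (\<lambda>x. (f x + c * g x)\<^sup>2)" .
  moreover have "(\<lambda>x. f x + c * g x) \<in> borel_measurable N"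
    using assms by measurable
  ultimately show ?thesis by (simp add: L2_fun_def)
qed

lemma L2_fun_zero: "L2_fun N (\<lambda>x. 0)"
  by (simp add: L2_fun_def)

lemma L2_fun_scale: "L2_fun N f \<Longrightarrow> L2_fun N (\<lambda>x. c * f x)"
  using L2_fun_lincomb[OF L2_fun_zero, of N f c] by simp

lemma L2_fun_diff: "L2_fun N f \<Longrightarrow> L2_fun N g \<Longrightarrow> L2_fun N (\<lambda>x. f x - g x)"
  using L2_fun_lincomb[of N f g "-1"] by simp

lemma L2_fun_sum:
  assumes "\<And>i. i \<in> A \<Longrightarrow> L2_fun N (f i)"
  shows "L2_fun N (\<lambda>x. \<Sum>i\<in>A. c i * f i x)"
  using assms
proof (induction A rule: infinite_finite_induct)
  case (insert i A)
  then have "L2_fun N (\<lambda>x. (\<Sum>i\<in>A. c i * f i x) + c i * f i x)"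
    by (intro L2_fun_lincomb) auto
  then show ?case using insert.hyps by (simp add: add.commute)
qed (simp_all add: L2_fun_zero)

lemma L2_integral_sq_diff:
  assumes "L2_fun N f" "L2_fun N g"
  shows "(\<integral>x. (f x - g x)\<^sup>2 \<partial>N) =
    (\<integral>x. (f x)\<^sup>2 \<partial>N) - 2 * (\<integral>x. f x * g x \<partial>N) + (\<integral>x. (g x)\<^sup>2 \<partial>N)"
proof -
  have "(\<integral>x. (f x - g x)\<^sup>2 \<partial>N) = (\<integral>x. ((f x)\<^sup>2 - 2 * (f x * g x)) + (g x)\<^sup>2 \<partial>N)"
    by (intro Bochner_Integration.integral_cong) (auto simp: power2_eq_square algebra_simps)
  also have "\<dots> = (\<integral>x. (f x)\<^sup>2 \<partial>N) - 2 * (\<integral>x. f x * g x \<partial>N) + (\<integral>x. (g x)\<^sup>2 \<partial>N)"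
    using assms L2_fun_integrable_mult[OF assms] by (simp add: L2_fun_def)
  finally show ?thesis .
qed

text \<open>
  From \<open>(u + v)\<^sup>2 \<le> 2 u\<^sup>2 + 2 v\<^sup>2\<close>. The constant is harmless for convergence, and this form
  avoids square roots of integrals.
\<close>

lemma L2_sq_diff_triangle:
  assumes "L2_fun N f" "L2_fun N g" "L2_fun N h"
  shows "(\<integral>x. (f x - h x)\<^sup>2 \<partial>N) \<le> 2 * (\<integral>x. (f x - g x)\<^sup>2 \<partial>N) + 2 * (\<integral>x. (g x - h x)\<^sup>2 \<partial>N)"
proof -
  have i: "integrable N (\<lambda>x. (f x - g x)\<^sup>2)" "integrable N (\<lambda>x. (g x - h x)\<^sup>2)"
      "integrable N (\<lambda>x. (f x - h x)\<^sup>2)"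
    using L2_fun_diff assms by (auto simp: L2_fun_def)
  have "(f x - h x)\<^sup>2 \<le> 2 * (f x - g x)\<^sup>2 + 2 * (g x - h x)\<^sup>2" for x
    using sum_squares_bound[of "f x - g x" "g x - h x"]
    by (simp add: power2_eq_square algebra_simps)
  then have "(\<integral>x. (f x - h x)\<^sup>2 \<partial>N) \<le> (\<integral>x. 2 * (f x - g x)\<^sup>2 + 2 * (g x - h x)\<^sup>2 \<partial>N)"
    using i by (intro integral_mono) auto
  then show ?thesis using i by simp
qed

text \<open>
  The quadratic polynomial \<open>\<integral>(f - t g)\<^sup>2\<close> in \<open>t\<close> is nonnegative.
\<close>

lemma L2_Cauchy_Schwarz:
  assumes "L2_fun N f" "L2_fun N g"
  shows "(\<integral>x. f x * g x \<partial>N)\<^sup>2 \<le> (\<integral>x. (f x)\<^sup>2 \<partial>N) * (\<integral>x. (g x)\<^sup>2 \<partial>N)"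
proof -
  define A B C where "A = (\<integral>x. (f x)\<^sup>2 \<partial>N)" and "B = (\<integral>x. f x * g x \<partial>N)"
    and "C = (\<integral>x. (g x)\<^sup>2 \<partial>N)"
  have q: "0 \<le> A - 2 * t * B + t\<^sup>2 * C" for t
  proof -
    have "0 \<le> (\<integral>x. (f x - t * g x)\<^sup>2 \<partial>N)" by simp
    also have "\<dots> = A - 2 * (\<integral>x. f x * (t * g x) \<partial>N) + (\<integral>x. (t * g x)\<^sup>2 \<partial>N)"
      unfolding A_def using assms by (intro L2_integral_sq_diff L2_fun_scale)
    also have "(\<integral>x. f x * (t * g x) \<partial>N) = t * B"
      unfolding B_def by (simp add: mult.left_commute)
    also have "(\<integral>x. (t * g x)\<^sup>2 \<partial>N) = t\<^sup>2 * C"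
      unfolding C_def by (simp add: power_mult_distrib)
    finally show ?thesis by (simp add: algebra_simps)
  qed
  have "C \<ge> 0" unfolding C_def by simp
  have "B\<^sup>2 \<le> A * C"
  proof (cases "C = 0")
    case True
    have "B = 0"
    proof (rule ccontr)
      assume "B \<noteq> 0"
      then show False using q[of "(A + 1) / (2 * B)"] True by simp
    qed
    then show ?thesis using True by simp
  next
    case False
    then have "C > 0" using \<open>C \<ge> 0\<close> by simp
    then have "0 \<le> A - B\<^sup>2 / C"
      using q[of "B / C"] by (simp add: power2_eq_square field_simps)
    then show ?thesis using \<open>C > 0\<close> by (simp add: field_simps)
  qed
  then show ?thesis by (simp add: A_def B_def C_def)
qed

lemma L2_tendsto_integral_mult:
  assumes "L2_tendsto N f g" "L2_fun N h"
  shows "(\<lambda>n. \<integral>x. f n x * h x \<partial>N) \<longlonglongrightarrow> (\<integral>x. g x * h x \<partial>N)"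
proof -
  have f: "L2_fun N (f n)" for n using assms by (simp add: L2_tendsto_def)
  have g: "L2_fun N g" and lim: "(\<lambda>n. \<integral>x. (f n x - g x)\<^sup>2 \<partial>N) \<longlonglongrightarrow> 0"
    using assms by (auto simp: L2_tendsto_def)
  let ?d = "\<lambda>n. (\<integral>x. (f n x - g x) * h x \<partial>N)"
  have "(\<lambda>n. (?d n)\<^sup>2) \<longlonglongrightarrow> 0"
  proof (rule tendsto_sandwich[where f = "\<lambda>_. 0"])
    show "\<forall>\<^sub>F n in sequentially. (?d n)\<^sup>2 \<le> (\<integral>x. (f n x - g x)\<^sup>2 \<partial>N) * (\<integral>x. (h x)\<^sup>2 \<partial>N)"
      using L2_Cauchy_Schwarz[OF L2_fun_diff[OF f g] assms(2)] by auto
    show "(\<lambda>n. (\<integral>x. (f n x - g x)\<^sup>2 \<partial>N) * (\<integral>x. (h x)\<^sup>2 \<partial>N)) \<longlonglongrightarrow> 0"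
      using tendsto_mult_left_zero[OF lim] by simp
  qed auto
  then have "(\<lambda>n. sqrt ((?d n)\<^sup>2)) \<longlonglongrightarrow> sqrt 0" by (rule tendsto_real_sqrt)
  then have "?d \<longlonglongrightarrow> 0" by (simp add: tendsto_rabs_zero_iff)
  moreover have "?d n = (\<integral>x. f n x * h x \<partial>N) - (\<integral>x. g x * h x \<partial>N)" for n
    using L2_fun_integrable_mult[OF f[of n] assms(2)] L2_fun_integrable_mult[OF g assms(2)]
    by (simp add: left_diff_distrib)
  ultimately show ?thesis by (simp add: LIM_zero_iff)
qed

text \<open>
  The Riesz-Fischer theorem. A subsequence whose consecutive distances decrease geometrically
  converges almost everywhere, and by Fatou's lemma its pointwise limit is also the limit in
  \<open>L\<^sup>2\<close> of the whole sequence.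
\<close>

lemma L2_complete:
  assumes f: "\<And>n. L2_fun N (f n)"
    and Cauchy: "\<And>e. e > 0 \<Longrightarrow> \<exists>n0. \<forall>m\<ge>n0. \<forall>n\<ge>n0. (\<integral>x. (f m x - f n x)\<^sup>2 \<partial>N) < e"
  shows "\<exists>g. L2_tendsto N f g"
proof -
  have [measurable]: "f n \<in> borel_measurable N" for n using f by measurable
  have d2: "L2_fun N (\<lambda>x. f m x - f n x)" for m n using f L2_fun_diff by blast
  have nn: "(\<integral>\<^sup>+x. ennreal ((f m x - f n x)\<^sup>2) \<partial>N) = ennreal (\<integral>x. (f m x - f n x)\<^sup>2 \<partial>N)" for m n
    using d2[of m n] by (intro nn_integral_eq_integral) (auto simp: L2_fun_def)
  have "\<exists>n0. \<forall>m\<ge>n0. \<forall>n\<ge>n0. (\<integral>x. (f m x - f n x)\<^sup>2 \<partial>N) < (1/8)^k" for k :: nat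
    by (rule Cauchy) simp
  then obtain n0 where n0:
      "\<And>k m n. m \<ge> n0 k \<Longrightarrow> n \<ge> n0 k \<Longrightarrow> (\<integral>x. (f m x - f n x)\<^sup>2 \<partial>N) < (1/8)^k"
    by metis
  define r where "r k = (\<Sum>j\<le>k. n0 j) + k" for k
  have r_ge: "r k \<ge> n0 k" for k
  proof -
    have "n0 k \<le> (\<Sum>j\<le>k. n0 j)" by (rule member_le_sum) auto
    then show ?thesis by (simp add: r_def)
  qed
  have r_Suc: "r (Suc k) \<ge> r k" for k by (simp add: r_def)
  have r_lim: "filterlim r at_top sequentially"
    by (rule filterlim_at_top_mono[OF filterlim_ident]) (simp add: r_def)
  define d where "d k x = f (r (Suc k)) x - f (r k) x" for k x
  have [measurable]: "d k \<in> borel_measurable N" for k unfolding d_def by measurable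
  \<comment> \<open>The weights \<open>4^k\<close> keep the bound \<open>\<Sum>(4/8)^k\<close> finite and force \<open>|d k x| < (1/2)^k\<close> eventually.\<close>
  have "(\<integral>\<^sup>+x. (\<Sum>k. ennreal (4^k * (d k x)\<^sup>2)) \<partial>N) = (\<Sum>k. \<integral>\<^sup>+x. ennreal (4^k * (d k x)\<^sup>2) \<partial>N)"
    by (rule nn_integral_suminf) measurable
  also have "\<dots> \<le> (\<Sum>k. ennreal ((1/2)^k))"
  proof (rule suminf_le)
    fix k
    have "(\<integral>\<^sup>+x. ennreal (4^k * (d k x)\<^sup>2) \<partial>N) = ennreal (4^k) * (\<integral>\<^sup>+x. ennreal ((d k x)\<^sup>2) \<partial>N)"
      by (simp add: ennreal_mult' nn_integral_cmult)
    also have "\<dots> \<le> ennreal (4^k) * ennreal ((1/8)^k)"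
      unfolding d_def nn using n0[of k "r (Suc k)" "r k"] r_ge[of k] r_Suc[of k]
      by (intro mult_left_mono ennreal_leI) auto
    also have "\<dots> = ennreal ((1/2)^k)"
      by (simp add: ennreal_mult'[symmetric] power_mult_distrib[symmetric])
    finally show "(\<integral>\<^sup>+x. ennreal (4^k * (d k x)\<^sup>2) \<partial>N) \<le> ennreal ((1/2)^k)" .
  qed auto
  also have "\<dots> < \<infinity>"
    by (subst suminf_ennreal2) (auto intro!: summable_geometric)
  finally have "AE x in N. (\<Sum>k. ennreal (4^k * (d k x)\<^sup>2)) \<noteq> \<infinity>"
    by (intro nn_integral_PInf_AE) auto
  then have conv: "AE x in N. convergent (\<lambda>k. f (r k) x)"
  proof eventually_elim
    case (elim x)
    then have s: "summable (\<lambda>k. 4^k * (d k x)\<^sup>2)"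
      by (intro summable_suminf_not_top) auto
    then have "(\<lambda>k. 4^k * (d k x)\<^sup>2) \<longlonglongrightarrow> 0" by (rule summable_LIMSEQ_zero)
    then have ev: "\<forall>\<^sub>F k in sequentially. 4^k * (d k x)\<^sup>2 < 1"
      by (rule order_tendstoD) simp
    have "summable (\<lambda>k. d k x)"
    proof (rule summable_comparison_test_ev)
      show "summable (\<lambda>k. (1/2::real)^k)" by (intro summable_geometric) simp
      show "\<forall>\<^sub>F k in sequentially. norm (d k x) \<le> (1/2)^k"
        using ev
      proof eventually_elim
        case (elim k)
        have "(2::real)^k * 2^k = 4^k" by (subst power_mult_distrib[symmetric]) simp
        then have "(2^k * \<bar>d k x\<bar>)\<^sup>2 = 4^k * (d k x)\<^sup>2"
          by (simp only: power_mult_distrib power2_abs power2_eq_square[of "2^k"])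
        then have "(2^k * \<bar>d k x\<bar>)\<^sup>2 < 1\<^sup>2" using elim by simp
        then have "2^k * \<bar>d k x\<bar> < 1" by (rule power2_less_imp_less) simp
        then have "\<bar>d k x\<bar> < 1 / 2^k" by (simp add: pos_less_divide_eq mult.commute)
        then show ?case by (simp add: power_one_over)
      qed
    qed
    then have "convergent (\<lambda>n. \<Sum>k<n. d k x)" by (simp add: summable_iff_convergent)
    then have "convergent (\<lambda>n. (\<Sum>k<n. d k x) + f (r 0) x)"
      by (intro convergent_add convergent_const)
    moreover have "(\<Sum>k<n. d k x) + f (r 0) x = f (r n) x" for n
      by (induction n) (auto simp: d_def)
    ultimately show ?case by simp
  qed
  define g where "g x = lim (\<lambda>k. f (r k) x)" for x
  have [measurable]: "g \<in> borel_measurable N" unfolding g_def by measurable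
  have AE_lim: "AE x in N. (\<lambda>k. f (r k) x) \<longlonglongrightarrow> g x"
    using conv by eventually_elim (simp add: g_def convergent_LIMSEQ_iff)
  have fatou: "(\<integral>\<^sup>+x. ennreal ((f n x - g x)\<^sup>2) \<partial>N) \<le> ennreal e"
    if e: "e > 0" and n1: "\<And>m. m \<ge> n1 \<Longrightarrow> (\<integral>x. (f n x - f m x)\<^sup>2 \<partial>N) < e" for n n1 e
  proof -
    have "(\<integral>\<^sup>+x. ennreal ((f n x - g x)\<^sup>2) \<partial>N)
        = (\<integral>\<^sup>+x. liminf (\<lambda>k. ennreal ((f n x - f (r k) x)\<^sup>2)) \<partial>N)"
    proof (rule nn_integral_cong_AE, use AE_lim in eventually_elim)
      case (elim x)
      then have "(\<lambda>k. ennreal ((f n x - f (r k) x)\<^sup>2)) \<longlonglongrightarrow> ennreal ((f n x - g x)\<^sup>2)"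
        by (intro tendsto_ennrealI tendsto_intros)
      then show ?case using lim_imp_Liminf[of sequentially] by fastforce
    qed
    also have "\<dots> \<le> liminf (\<lambda>k. \<integral>\<^sup>+x. ennreal ((f n x - f (r k) x)\<^sup>2) \<partial>N)"
      by (rule nn_integral_liminf) measurable
    also have "\<dots> \<le> liminf (\<lambda>k. ennreal e)"
    proof (rule Liminf_mono)
      have "\<forall>\<^sub>F k in sequentially. r k \<ge> n1"
        using r_lim by (auto simp: filterlim_at_top)
      then show "\<forall>\<^sub>F k in sequentially.
          (\<integral>\<^sup>+x. ennreal ((f n x - f (r k) x)\<^sup>2) \<partial>N) \<le> ennreal e"
        by eventually_elim (use n1 in \<open>force simp: nn intro!: ennreal_leI\<close>)
    qed
    finally show ?thesis by (simp add: Liminf_const)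
  qed
  have fg: "L2_fun N (\<lambda>x. f n x - g x)"
    if "e > 0" and n1: "\<And>m. m \<ge> n1 \<Longrightarrow> (\<integral>x. (f n x - f m x)\<^sup>2 \<partial>N) < e" for n n1 e
  proof -
    have "(\<integral>\<^sup>+x. ennreal ((f n x - g x)\<^sup>2) \<partial>N) < \<infinity>"
      using le_less_trans[OF fatou[OF that] ennreal_less_top] by simp
    then have "integrable N (\<lambda>x. (f n x - g x)\<^sup>2)" by (intro integrableI_bounded) auto
    then show ?thesis by (simp add: L2_fun_def)
  qed
  have small: "(\<integral>x. (f n x - g x)\<^sup>2 \<partial>N) \<le> e"
    if "e > 0" and n1: "\<And>m. m \<ge> n1 \<Longrightarrow> (\<integral>x. (f n x - f m x)\<^sup>2 \<partial>N) < e" for n n1 e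
  proof -
    have "ennreal (\<integral>x. (f n x - g x)\<^sup>2 \<partial>N) \<le> ennreal e"
      using fatou[OF that] fg[OF that] by (subst nn_integral_eq_integral[symmetric]) (auto simp: L2_fun_def)
    then show ?thesis using \<open>e > 0\<close> by simp
  qed
  have "L2_fun N g"
  proof -
    obtain n1 where "\<forall>m\<ge>n1. \<forall>n\<ge>n1. (\<integral>x. (f m x - f n x)\<^sup>2 \<partial>N) < 1" using Cauchy[of 1] by auto
    then have "L2_fun N (\<lambda>x. f n1 x - g x)" by (intro fg[of 1 n1]) auto
    then show ?thesis using L2_fun_diff[OF f[of n1], of "\<lambda>x. f n1 x - g x"] by simp
  qed
  moreover have "(\<lambda>n. \<integral>x. (f n x - g x)\<^sup>2 \<partial>N) \<longlonglongrightarrow> 0"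
  proof (rule LIMSEQ_I)
    fix e :: real assume e: "e > 0"
    then obtain n1 where "\<forall>m\<ge>n1. \<forall>n\<ge>n1. (\<integral>x. (f m x - f n x)\<^sup>2 \<partial>N) < e/2"
      using Cauchy[of "e/2"] by auto
    then have "\<forall>n\<ge>n1. (\<integral>x. (f n x - g x)\<^sup>2 \<partial>N) \<le> e/2" using small[of "e/2" n1] e by auto
    then show "\<exists>n0. \<forall>n\<ge>n0. norm ((\<integral>x. (f n x - g x)\<^sup>2 \<partial>N) - 0) < e"
      using e by (intro exI[of _ n1]) force
  qed
  ultimately show ?thesis using f by (auto simp: L2_tendsto_def)
qed

lemma L2_tendsto_Cauchy:
  assumes "L2_tendsto N f g" "e > 0"
  shows "\<exists>n0. \<forall>m\<ge>n0. \<forall>n\<ge>n0. (\<integral>x. (f m x - f n x)\<^sup>2 \<partial>N) < e"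
proof -
  have "\<forall>\<^sub>F n in sequentially. (\<integral>x. (f n x - g x)\<^sup>2 \<partial>N) < e/4"
    using assms by (intro order_tendstoD[where y=0]) (auto simp: L2_tendsto_def)
  then obtain n0 where n0: "\<And>n. n \<ge> n0 \<Longrightarrow> (\<integral>x. (f n x - g x)\<^sup>2 \<partial>N) < e/4"
    by (auto simp: eventually_sequentially)
  have "(\<integral>x. (f m x - f n x)\<^sup>2 \<partial>N) < e" if "m \<ge> n0" "n \<ge> n0" for m n
    using L2_sq_diff_triangle[of N "f m" g "f n"] n0[OF that(1)] n0[OF that(2)] assms(1)
    by (auto simp: L2_tendsto_def power2_commute)
  then show ?thesis by blast
qed

text \<open>
  The square of the distance from \<open>f\<close> to a partial sum of its expansion, which is
  nonnegative, is \<open>\<integral>f\<^sup>2\<close> minus the sum of the squares of the first coefficients.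
\<close>

lemma L2_Bessel:
  assumes e: "\<And>k. L2_fun N (e k)"
    and orth: "\<And>j k. (\<integral>x. e j x * e k x \<partial>N) = (if j = k then 1 else 0)"
    and f: "L2_fun N f"
  shows "summable (\<lambda>k. (\<integral>x. f x * e k x \<partial>N)\<^sup>2)"
proof -
  define a where "a k = (\<integral>x. f x * e k x \<partial>N)" for k
  have "(\<Sum>k<n. (a k)\<^sup>2) \<le> (\<integral>x. (f x)\<^sup>2 \<partial>N)" for n
  proof -
    let ?s = "\<lambda>x. \<Sum>k<n. a k * e k x"
    have s: "L2_fun N ?s" by (rule L2_fun_sum) (rule e)
    have "(\<integral>x. f x * ?s x \<partial>N) = (\<Sum>k<n. a k * (\<integral>x. f x * e k x \<partial>N))"
      using L2_fun_integrable_mult[OF f e]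
      by (simp add: sum_distrib_left mult.left_commute Bochner_Integration.integral_sum)
    moreover have "(\<integral>x. (?s x)\<^sup>2 \<partial>N) = (\<Sum>k<n. a k * (\<Sum>j<n. a j * (\<integral>x. e j x * e k x \<partial>N)))"
    proof -
      have "(\<integral>x. (?s x)\<^sup>2 \<partial>N) = (\<integral>x. (\<Sum>k<n. a k * (\<Sum>j<n. a j * (e j x * e k x))) \<partial>N)"
        by (intro Bochner_Integration.integral_cong)
           (auto simp: power2_eq_square sum_distrib_left sum_distrib_right algebra_simps)
      then show ?thesis using L2_fun_integrable_mult[OF e e]
        by (simp add: Bochner_Integration.integral_sum)
    qed
    ultimately have "(\<integral>x. (f x - ?s x)\<^sup>2 \<partial>N) = (\<integral>x. (f x)\<^sup>2 \<partial>N) - (\<Sum>k<n. (a k)\<^sup>2)"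
      unfolding L2_integral_sq_diff[OF f s]
      by (simp add: orth a_def[symmetric] power2_eq_square if_distrib cong: if_cong)
    moreover have "(\<integral>x. (f x - ?s x)\<^sup>2 \<partial>N) \<ge> 0" by simp
    ultimately show ?thesis by linarith
  qed
  then show ?thesis unfolding a_def[symmetric] by (intro summableI_nonneg_bounded) auto
qed

text \<open>
  By orthonormality the partial sums are as far apart in \<open>L\<^sup>2\<close> as those of \<open>\<Sum>a\<^sub>k\<^sup>2\<close> in
  \<open>\<real>\<close>, so they form a Cauchy sequence.
\<close>

lemma L2_orthonormal_series_converges:
  assumes e: "\<And>k. L2_fun N (e k)"
    and orth: "\<And>j k. (\<integral>x. e j x * e k x \<partial>N) = (if j = k then 1 else 0)"
    and a: "summable (\<lambda>k. (a k)\<^sup>2)"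
  shows "\<exists>g. L2_tendsto N (\<lambda>n x. \<Sum>k<n. a k * e k x) g"
proof (rule L2_complete)
  show L2: "L2_fun N (\<lambda>x. \<Sum>k<n. a k * e k x)" for n by (rule L2_fun_sum) (rule e)
  define S where "S n x = (\<Sum>k<n. a k * e k x)" for n x
  have inner: "(\<integral>x. S m x * S n x \<partial>N) = (\<Sum>k<m. (a k)\<^sup>2)" if "m \<le> n" for m n
  proof -
    have "(\<integral>x. S m x * S n x \<partial>N) = (\<integral>x. (\<Sum>k<m. a k * (\<Sum>j<n. a j * (e k x * e j x))) \<partial>N)"
      unfolding S_def sum_product
      by (intro Bochner_Integration.integral_cong sum.cong refl)
         (simp add: sum_distrib_left mult_ac)
    also have "\<dots> = (\<Sum>k<m. a k * (\<Sum>j<n. a j * (\<integral>x. e k x * e j x \<partial>N)))"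
      using L2_fun_integrable_mult[OF e e] by (simp add: Bochner_Integration.integral_sum)
    also have "\<dots> = (\<Sum>k<m. (a k)\<^sup>2)"
      using that by (intro sum.cong refl) (auto simp: orth power2_eq_square if_distrib cong: if_cong)
    finally show ?thesis .
  qed
  have sq: "(\<integral>x. (S m x - S n x)\<^sup>2 \<partial>N) = \<bar>(\<Sum>k<m. (a k)\<^sup>2) - (\<Sum>k<n. (a k)\<^sup>2)\<bar>" for m n
  proof -
    have *: "(\<integral>x. (S m x - S n x)\<^sup>2 \<partial>N) = (\<Sum>k<n. (a k)\<^sup>2) - (\<Sum>k<m. (a k)\<^sup>2)" if "m \<le> n" for m n
      using L2_integral_sq_diff[OF L2 L2, of m n] inner[OF that] inner[of m m] inner[of n n]
      by (simp add: S_def power2_eq_square)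
    show ?thesis
    proof (cases "m \<le> n")
      case True
      then show ?thesis using *[OF True] sum_mono2[of "{..<n}" "{..<m}" "\<lambda>k. (a k)\<^sup>2"] by auto
    next
      case False
      then show ?thesis using *[of n m] sum_mono2[of "{..<m}" "{..<n}" "\<lambda>k. (a k)\<^sup>2"]
        by (auto simp: power2_commute)
    qed
  qed
  fix \<epsilon> :: real assume "\<epsilon> > 0"
  moreover have "Cauchy (\<lambda>n. \<Sum>k<n. (a k)\<^sup>2)"
    using a by (simp add: summable_iff_convergent Cauchy_convergent_iff)
  ultimately show "\<exists>n0. \<forall>m\<ge>n0. \<forall>n\<ge>n0.
      (\<integral>x. ((\<Sum>k<m. a k * e k x) - (\<Sum>k<n. a k * e k x))\<^sup>2 \<partial>N) < \<epsilon>"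
    unfolding S_def[symmetric] sq by (auto simp: Cauchy_def dist_real_def)
qed

section \<open>Orthonormality and boundedness of the Hermite functions\<close>

text \<open>
  The recursion that differentiating \<open>p e^(-x\<^sup>2)\<close> induces on the polynomial factor. Working with
  polynomials makes derivatives and Gaussian integrals algebraic.
\<close>

fun hermite_poly :: "nat \<Rightarrow> real poly" where
  "hermite_poly 0 = 1"
| "hermite_poly (Suc n) = [:0, 2:] * hermite_poly n - pderiv (hermite_poly n)"

text \<open>
  The linear functional on polynomials in which the inner products of Hermite functions are
  computed.
\<close>

definition gauss_integral :: "real poly \<Rightarrow> real" where
  "gauss_integral p = (\<integral>x. poly p x * exp (- x\<^sup>2) \<partial>lebesgue)"

text \<open>
  The squared norm of the Hermite polynomial of degree \<open>n\<close> for the Gaussian weight.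
\<close>

definition hermite_norm :: "nat \<Rightarrow> real" where
  "hermite_norm n = 2 ^ n * fact n * sqrt pi"

lemma pderiv_hermite_poly:
  "pderiv (hermite_poly (Suc n)) = smult (2 * (real n + 1)) (hermite_poly n)"
proof (induction n)
  case 0
  then show ?case by (simp add: pderiv_pCons)
next
  case (Suc n)
  have c: "pderiv [:0, 2::real:] = [:2:]" by (simp add: pderiv_pCons)
  have "pderiv (hermite_poly (Suc (Suc n)))
      = [:2:] * hermite_poly (Suc n) + [:0, 2:] * pderiv (hermite_poly (Suc n))
        - pderiv (pderiv (hermite_poly (Suc n)))"
    unfolding hermite_poly.simps(2)[of "Suc n"] pderiv_diff pderiv_mult c by (simp add: algebra_simps)
  also have "\<dots> = smult 2 (hermite_poly (Suc n))
      + smult (2 * (real n + 1)) ([:0, 2:] * hermite_poly n - pderiv (hermite_poly n))"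
    unfolding Suc.IH by (simp add: pderiv_smult smult_diff_right)
  also have "\<dots> = smult (2 + 2 * (real n + 1)) (hermite_poly (Suc n))"
    by (simp only: hermite_poly.simps(2)[symmetric] smult_add_left)
  also have "2 + 2 * (real n + 1) = 2 * (real (Suc n) + 1)" by simp
  finally show ?case .
qed

lemma DERIV_poly_gauss:
  "((\<lambda>x::real. poly p x * exp (- x\<^sup>2)) has_real_derivative
     poly (pderiv p - [:0, 2:] * p) x * exp (- x\<^sup>2)) (at x)"
  by (auto intro!: derivative_eq_intros simp: algebra_simps)

lemma hermite_H_eq: "hermite_H n t = poly (hermite_poly n) t"
proof -
  have "(deriv ^^ n) (\<lambda>x. exp (- x\<^sup>2)) = (\<lambda>x::real. (-1) ^ n * (poly (hermite_poly n) x * exp (- x\<^sup>2)))"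
  proof (induction n)
    case (Suc n)
    have "((\<lambda>x. (-1) ^ n * (poly (hermite_poly n) x * exp (- x\<^sup>2))) has_real_derivative
        (-1) ^ n * (poly (pderiv (hermite_poly n) - [:0, 2:] * hermite_poly n) x * exp (- x\<^sup>2))) (at x)"
      for x :: real
      by (rule DERIV_cmult) (rule DERIV_poly_gauss)
    from DERIV_imp_deriv[OF this] show ?case
      by (simp add: Suc.IH fun_eq_iff algebra_simps)
  qed simp
  then have "hermite_H n t
      = ((-1) ^ n * (-1) ^ n) * (exp (t\<^sup>2) * exp (- t\<^sup>2)) * poly (hermite_poly n) t"
    by (simp add: hermite_H_def mult_ac)
  then show ?thesis by (simp add: exp_minus flip: power_mult_distrib)
qed

lemma hermite_psi_eq:
  "hermite_psi n t = poly (hermite_poly n) t * exp (- t\<^sup>2 / 2) / sqrt (hermite_norm n)"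
  by (simp add: hermite_psi_def hermite_H_eq hermite_norm_def)

lemma hermite_norm_pos: "hermite_norm n > 0"
  by (simp add: hermite_norm_def)

lemma hermite_norm_Suc: "hermite_norm (Suc n) = 2 * (real n + 1) * hermite_norm n"
  by (simp add: hermite_norm_def algebra_simps)

lemma hermite_psi_mult:
  "hermite_psi m t * hermite_psi n t = poly (hermite_poly m * hermite_poly n) t * exp (- t\<^sup>2)
     / (sqrt (hermite_norm m) * sqrt (hermite_norm n))"
proof -
  have "exp (- t\<^sup>2 / 2) * exp (- t\<^sup>2 / 2) = exp (- t\<^sup>2)" by (simp add: mult_exp_exp)
  then show ?thesis by (simp add: hermite_psi_eq field_simps)
qed

text \<open>
  The weight \<open>e^(-x\<^sup>2)\<close> is a multiple of the normal density of variance \<open>1/2\<close>, which has all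
  moments.
\<close>

lemma integrable_poly_gauss: "integrable lborel (\<lambda>x::real. poly p x * exp (- x\<^sup>2))"
proof -
  have m: "integrable lborel (\<lambda>x::real. x ^ k * exp (- x\<^sup>2))" for k
  proof -
    have "integrable lborel (\<lambda>x. sqrt pi * (normal_density 0 (sqrt (1/2)) x * (x - 0) ^ k))"
      by (intro integrable_mult_right integrable_normal_moment) simp
    also have "(\<lambda>x. sqrt pi * (normal_density 0 (sqrt (1/2)) x * (x - 0) ^ k)) = (\<lambda>x. x ^ k * exp (- x\<^sup>2))"
      by (simp add: normal_density_def fun_eq_iff)
    finally show ?thesis .
  qed
  have "integrable lborel (\<lambda>x. \<Sum>i\<le>degree p. coeff p i * (x ^ i * exp (- x\<^sup>2)))"
    by (intro Bochner_Integration.integrable_sum integrable_mult_right m)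
  then show ?thesis by (simp add: poly_altdef sum_distrib_right mult.assoc)
qed

lemma integrable_poly_gauss_lebesgue: "integrable lebesgue (\<lambda>x::real. poly p x * exp (- x\<^sup>2))"
  using integrable_poly_gauss[of p] by (subst integrable_completion) auto

lemma poly_gauss_tendsto_0: "((\<lambda>x::real. poly p x * exp (- x\<^sup>2)) \<longlongrightarrow> 0) at_top"
proof -
  have m: "((\<lambda>x::real. x ^ k * exp (- x\<^sup>2)) \<longlongrightarrow> 0) at_top" for k
  proof (rule tendsto_sandwich[where f = "\<lambda>_. 0"])
    show "((\<lambda>x::real. x ^ k / exp x) \<longlongrightarrow> 0) at_top" by (rule tendsto_power_div_exp_0)
    show "\<forall>\<^sub>F x::real in at_top. x ^ k * exp (- x\<^sup>2) \<le> x ^ k / exp x"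
      using eventually_ge_at_top[of 1]
    proof eventually_elim
      case (elim x)
      then have "x \<le> x\<^sup>2" by (simp add: power2_eq_square)
      then show ?case using elim by (auto simp: exp_minus field_simps)
    qed
    show "\<forall>\<^sub>F x::real in at_top. 0 \<le> x ^ k * exp (- x\<^sup>2)"
      using eventually_ge_at_top[of 0] by eventually_elim simp
  qed auto
  have "((\<lambda>x. \<Sum>i\<le>degree p. coeff p i * (x ^ i * exp (- x\<^sup>2))) \<longlongrightarrow> (\<Sum>i\<le>degree p. coeff p i * 0)) at_top"
    by (intro tendsto_intros m)
  then show ?thesis by (simp add: poly_altdef sum_distrib_right mult.assoc)
qed

lemma gauss_integral_add: "gauss_integral (p + q) = gauss_integral p + gauss_integral q"
  using integrable_poly_gauss_lebesgue[of p] integrable_poly_gauss_lebesgue[of q]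
  by (simp add: gauss_integral_def distrib_right)

lemma gauss_integral_smult: "gauss_integral (smult c p) = c * gauss_integral p"
  by (simp add: gauss_integral_def mult.assoc)

text \<open>
  The function \<open>p e^(-x\<^sup>2)\<close> vanishes at \<open>\<plusminus>\<infinity>\<close>, so the integral of its derivative is zero.
\<close>

lemma gauss_integral_by_parts: "gauss_integral ([:0, 2:] * p) = gauss_integral (pderiv p)"
proof -
  let ?q = "pderiv p - [:0, 2:] * p"
  have bot: "((\<lambda>x. poly p x * exp (- x\<^sup>2)) \<longlongrightarrow> 0) at_bot"
    using poly_gauss_tendsto_0[of "pcompose p [:0, -1:]"]
    by (simp add: filterlim_at_bot_mirror poly_pcompose)
  have "(LBINT x=-\<infinity>..\<infinity>. poly ?q x * exp (- x\<^sup>2)) = 0 - 0"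
  proof (rule interval_integral_FTC_integrable[where F="\<lambda>x. poly p x * exp (- x\<^sup>2)"])
    show "((\<lambda>x. poly p x * exp (- x\<^sup>2)) has_vector_derivative poly ?q x * exp (- x\<^sup>2)) (at x)" for x
      using DERIV_poly_gauss by (simp add: has_real_derivative_iff_has_vector_derivative)
    show "isCont (\<lambda>x. poly ?q x * exp (- x\<^sup>2)) x" for x by (intro continuous_intros)
    show "set_integrable lborel (einterval (- \<infinity>) \<infinity>) (\<lambda>x. poly ?q x * exp (- x\<^sup>2))"
      using integrable_poly_gauss[of ?q] by (simp add: set_integrable_def einterval_def)
    show "(((\<lambda>x. poly p x * exp (- x\<^sup>2)) \<circ> real_of_ereal) \<longlongrightarrow> 0) (at_right (- \<infinity>))"
      using bot by (simp add: ereal_tendsto_simps)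
    show "(((\<lambda>x. poly p x * exp (- x\<^sup>2)) \<circ> real_of_ereal) \<longlongrightarrow> 0) (at_left \<infinity>)"
      using poly_gauss_tendsto_0 by (simp add: ereal_tendsto_simps)
  qed auto
  then have "(\<integral>x. poly ?q x * exp (- x\<^sup>2) \<partial>lborel) = 0"
    by (simp add: interval_lebesgue_integral_def set_lebesgue_integral_def einterval_def)
  then have "gauss_integral ?q = 0"
    unfolding gauss_integral_def
    by (subst integral_completion) (rule borel_measurable_integrable[OF integrable_poly_gauss])
  then show ?thesis
    using gauss_integral_add[of ?q "[:0, 2:] * p"] by simp
qed

text \<open>
  With respect to the Gaussian weight, passing from one Hermite polynomial to the next is
  adjoint to differentiation.
\<close>

lemma gauss_integral_mult_hermite_Suc:
  "gauss_integral (p * hermite_poly (Suc n)) = gauss_integral (pderiv p * hermite_poly n)"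
proof -
  have "gauss_integral (p * hermite_poly (Suc n)) + gauss_integral (p * pderiv (hermite_poly n))
      = gauss_integral ([:0, 2:] * (p * hermite_poly n))"
    by (simp add: gauss_integral_add[symmetric] algebra_simps)
  also have "\<dots> = gauss_integral (pderiv p * hermite_poly n) + gauss_integral (p * pderiv (hermite_poly n))"
    by (simp only: gauss_integral_by_parts pderiv_mult gauss_integral_add) (simp add: mult.commute)
  finally show ?thesis by simp
qed

lemma gauss_integral_1: "gauss_integral 1 = sqrt pi"
proof -
  have "(\<integral>x. exp (- x\<^sup>2) \<partial>lborel) = (\<integral>x. sqrt pi * normal_density 0 (sqrt (1/2)) x \<partial>lborel)"
    by (simp add: normal_density_def)
  also have "\<dots> = sqrt pi" by simp
  finally show ?thesis by (simp add: gauss_integral_def integral_completion)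
qed

text \<open>
  Adjointness moves one step from one factor to a derivative of the other, which lowers the
  degrees of both factors by one; the induction ends with the derivative of a constant or with the
  integral of the weight.
\<close>

lemma gauss_integral_hermite_mult:
  "gauss_integral (hermite_poly m * hermite_poly n) = (if m = n then hermite_norm n else 0)"
proof (induction n arbitrary: m)
  case 0
  show ?case
  proof (cases m)
    case 0
    then show ?thesis by (simp add: gauss_integral_1 hermite_norm_def)
  next
    case (Suc k)
    have "gauss_integral (hermite_poly m * hermite_poly 0) = gauss_integral (1 * hermite_poly (Suc k))"
      using Suc by simp
    also have "\<dots> = 0"
      by (simp only: gauss_integral_mult_hermite_Suc) (simp add: gauss_integral_def)
    finally show ?thesis using Suc by simp
  qed
next
  case (Suc n)
  show ?case
  proof (cases m)
    case 0
    then show ?thesis by (simp only: gauss_integral_mult_hermite_Suc) (simp add: gauss_integral_def)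
  next
    case (Suc k)
    then show ?thesis
      by (simp only: gauss_integral_mult_hermite_Suc pderiv_hermite_poly mult_smult_left
          gauss_integral_smult Suc.IH) (simp add: hermite_norm_Suc)
  qed
qed

lemma continuous_hermite_psi: "continuous_on A (hermite_psi n)"
  unfolding hermite_psi_eq[abs_def] using hermite_norm_pos[of n]
  by (intro continuous_intros) auto

lemma hermite_psi_measurable: "hermite_psi n \<in> borel_measurable lebesgue"
  by (intro measurable_completion) (simp add: borel_measurable_continuous_onI continuous_hermite_psi)

lemma hermite_psi_orthonormal:
  "(\<integral>x. hermite_psi m x * hermite_psi n x \<partial>lebesgue) = (if m = n then 1 else 0)"
proof -
  have "(\<integral>x. hermite_psi m x * hermite_psi n x \<partial>lebesgue)
      = gauss_integral (hermite_poly m * hermite_poly n) / (sqrt (hermite_norm m) * sqrt (hermite_norm n))"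
    unfolding gauss_integral_def hermite_psi_mult by (rule integral_divide_zero)
  then show ?thesis
    using hermite_norm_pos[of n] by (simp add: gauss_integral_hermite_mult)
qed

lemma L2_fun_hermite_psi: "L2_fun lebesgue (hermite_psi n)"
  unfolding L2_fun_def power2_eq_square[of "hermite_psi _ _"] hermite_psi_mult
  by (intro conjI hermite_psi_measurable integrable_divide integrable_poly_gauss_lebesgue)

text \<open>
  Comparing the two expressions for the derivative of the next Hermite polynomial, from its
  recursion and from \<open>pderiv_hermite_poly\<close>, yields the Hermite differential equation.
\<close>

lemma poly_hermite_poly_ODE:
  "poly (pderiv (pderiv (hermite_poly n))) x
     = 2 * x * poly (pderiv (hermite_poly n)) x - 2 * real n * poly (hermite_poly n) x"
proof -
  have "pderiv (hermite_poly (Suc n))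
      = [:2:] * hermite_poly n + [:0, 2:] * pderiv (hermite_poly n) - pderiv (pderiv (hermite_poly n))"
    by (simp add: pderiv_diff pderiv_mult pderiv_pCons pderiv_smult algebra_simps)
  from arg_cong[OF this, of "\<lambda>p. poly p x"] show ?thesis
    unfolding pderiv_hermite_poly by (simp add: algebra_simps)
qed

text \<open>
  Up to normalization, \<open>G\<close> below is the energy \<open>(2 n + 1 - x\<^sup>2) \<psi>\<^sup>2 + \<psi>'\<^sup>2\<close>. Since
  \<open>\<psi>'' = (x\<^sup>2 - 2 n - 1) \<psi>\<close>, its derivative reduces to \<open>-2 x \<psi>\<^sup>2\<close>, so it increases up to \<open>0\<close>
  and decreases from there on.
\<close>

lemma hermite_psi_energy_le:
  defines "H n \<equiv> poly (hermite_poly n)" and "H' n \<equiv> poly (pderiv (hermite_poly n))"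
  shows "(2 * real n + 1 - t\<^sup>2) * (H n t)\<^sup>2 * exp (- t\<^sup>2) \<le> (2 * real n + 1) * (H n 0)\<^sup>2 + (H' n 0)\<^sup>2"
proof -
  define G where "G x = ((2 * real n + 1 - x\<^sup>2) * (H n x)\<^sup>2 + (H' n x - x * H n x)\<^sup>2) * exp (- x\<^sup>2)" for x
  have G': "(G has_real_derivative - 2 * x * (H n x)\<^sup>2 * exp (- x\<^sup>2)) (at x)" for x
  proof -
    have H: "(H n has_real_derivative H' n x) (at x)"
      unfolding H_def H'_def by (rule poly_DERIV)
    have H': "(H' n has_real_derivative 2 * x * H' n x - 2 * real n * H n x) (at x)"
      unfolding H_def H'_def poly_hermite_poly_ODE[symmetric] by (rule poly_DERIV)
    show ?thesis unfolding G_def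
      by (rule derivative_eq_intros H H' refl)+ (simp add: power2_eq_square algebra_simps)
  qed
  have "G t \<le> G 0"
  proof (cases "t \<ge> 0")
    case True
    show ?thesis
      using True G' by (intro DERIV_nonpos_imp_nonincreasing[of 0 t G]) (force intro!: mult_nonneg_nonneg)+
  next
    case False
    show ?thesis
      using False G' by (intro DERIV_nonneg_imp_nondecreasing[of t 0 G]) (force intro!: mult_nonneg_nonneg mult_nonpos_nonneg)+
  qed
  moreover have "(2 * real n + 1 - t\<^sup>2) * (H n t)\<^sup>2 * exp (- t\<^sup>2) \<le> G t"
    unfolding G_def by (intro mult_right_mono) auto
  moreover have "G 0 = (2 * real n + 1) * (H n 0)\<^sup>2 + (H' n 0)\<^sup>2" by (simp add: G_def)
  ultimately show ?thesis by linarith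
qed

text \<open>
  In steps of two the value at the origin is multiplied by \<open>-2 (k + 1)\<close>, while the squared norm
  grows by the larger factor \<open>4 (k + 1) (k + 2)\<close>.
\<close>

lemma hermite_poly_0_le: "(poly (hermite_poly n) 0)\<^sup>2 \<le> hermite_norm n"
proof (induction n rule: nat_less_induct)
  case (1 n)
  have pi: "1 \<le> sqrt pi" using pi_ge_two by simp
  consider "n = 0" | "n = 1" | k where "n = Suc (Suc k)" by (metis One_nat_def not0_implies_Suc)
  then show ?case
  proof cases
    case 3
    have "poly (hermite_poly n) 0 = - (2 * (real k + 1)) * poly (hermite_poly k) 0"
      unfolding 3 hermite_poly.simps(2)[of "Suc k"] pderiv_hermite_poly by (simp add: algebra_simps)
    then have "(poly (hermite_poly n) 0)\<^sup>2 = (2 * (real k + 1))\<^sup>2 * (poly (hermite_poly k) 0)\<^sup>2"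
      by (simp only: power_mult_distrib power2_minus)
    also have "\<dots> \<le> (2 * (real k + 1))\<^sup>2 * hermite_norm k"
      using 1 3 by (intro mult_left_mono) auto
    also have "\<dots> \<le> (2 * (real k + 2)) * (2 * (real k + 1)) * hermite_norm k"
      using hermite_norm_pos[of k] unfolding power2_eq_square by (intro mult_right_mono) auto
    also have "\<dots> = hermite_norm n" by (simp add: 3 hermite_norm_Suc algebra_simps)
    finally show ?thesis .
  qed (use pi in \<open>simp_all add: hermite_norm_def\<close>)
qed

text \<open>
  For \<open>2 t\<^sup>2 \<le> 2 n + 1\<close> the coefficient of \<open>\<psi>\<^sup>2\<close> in the energy is at least half its value
  at \<open>0\<close>, and both parts of the energy at \<open>0\<close> are at most \<open>2 n + 1\<close>.
\<close>

lemma hermite_psi_sq_le: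
  assumes "2 * t\<^sup>2 \<le> 2 * real n + 1"
  shows "(hermite_psi n t)\<^sup>2 \<le> 4"
proof -
  let ?H = "\<lambda>n. poly (hermite_poly n)"
  let ?c = "2 * real n + 1"
  have d: "(poly (pderiv (hermite_poly n)) 0)\<^sup>2 \<le> 2 * real n * hermite_norm n"
  proof (cases n)
    case (Suc k)
    have "(poly (pderiv (hermite_poly n)) 0)\<^sup>2 = (2 * (real k + 1))\<^sup>2 * (?H k 0)\<^sup>2"
      unfolding Suc pderiv_hermite_poly by (simp add: power_mult_distrib)
    also have "\<dots> \<le> (2 * (real k + 1))\<^sup>2 * hermite_norm k"
      by (intro mult_left_mono hermite_poly_0_le) simp
    finally show ?thesis by (simp add: Suc hermite_norm_Suc power2_eq_square algebra_simps)
  qed simp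
  have psi: "(hermite_psi n t)\<^sup>2 * hermite_norm n = (?H n t)\<^sup>2 * exp (- t\<^sup>2)"
    using hermite_norm_pos[of n] by (simp add: power2_eq_square hermite_psi_mult)
  have "?c / 2 * ((?H n t)\<^sup>2 * exp (- t\<^sup>2)) \<le> (?c - t\<^sup>2) * ((?H n t)\<^sup>2 * exp (- t\<^sup>2))"
    using assms by (intro mult_right_mono) auto
  also have "\<dots> \<le> ?c * (?H n 0)\<^sup>2 + (poly (pderiv (hermite_poly n)) 0)\<^sup>2"
    using hermite_psi_energy_le[of n t] by (simp add: mult.assoc)
  also have "\<dots> \<le> ?c * hermite_norm n + ?c * hermite_norm n"
    using hermite_poly_0_le[of n] d hermite_norm_pos[of n]
    by (intro add_mono mult_left_mono) (auto simp: algebra_simps)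
  finally have "?c * (((?H n t)\<^sup>2 * exp (- t\<^sup>2)) / 2) \<le> ?c * (2 * hermite_norm n)"
    by (simp add: algebra_simps)
  then have "(?H n t)\<^sup>2 * exp (- t\<^sup>2) / 2 \<le> 2 * hermite_norm n"
    by (rule mult_left_le_imp_le) simp
  then show ?thesis
    unfolding psi[symmetric] using hermite_norm_pos[of n] by (simp add: field_simps)
qed

lemma hermite_psi_bounded: "\<exists>B. \<forall>n. (hermite_psi n t)\<^sup>2 \<le> B"
proof -
  obtain N :: nat where N: "t\<^sup>2 \<le> real N" using real_arch_simple by blast
  have "(hermite_psi n t)\<^sup>2 \<le> 4 + (\<Sum>k<N. (hermite_psi k t)\<^sup>2)" for n
  proof (cases "n < N")
    case True
    then have "(hermite_psi n t)\<^sup>2 \<le> (\<Sum>k<N. (hermite_psi k t)\<^sup>2)"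
      by (intro member_le_sum) auto
    then show ?thesis by simp
  next
    case False
    then have "(hermite_psi n t)\<^sup>2 \<le> 4" using N by (intro hermite_psi_sq_le) simp
    then show ?thesis by (simp add: add_increasing2 sum_nonneg)
  qed
  then show ?thesis by blast
qed

section \<open>Second moments of the increments\<close>

text \<open>
  The length of an intersection of intervals in the form that polarization produces from the
  variances \<open>|t - s|\<close>; see \<open>increment_covariance\<close>.
\<close>

lemma interval_overlap_length:
  fixes a b c d :: real
  assumes "a \<le> b" "c \<le> d"
  shows "2 * (\<integral>x. indicator {a<..b} x * indicator {c<..d} x \<partial>lebesgue)
    = \<bar>b - c\<bar> + \<bar>a - d\<bar> - \<bar>b - d\<bar> - \<bar>a - c\<bar>"
proof -
  have "(\<integral>x. indicator {a<..b} x * indicator {c<..d} x \<partial>lebesgue)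
      = (\<integral>x. indicator {max a c<..min b d} x \<partial>lebesgue :: real)"
    by (intro Bochner_Integration.integral_cong) (auto simp: indicator_def)
  also have "\<dots> = (if max a c \<le> min b d then min b d - max a c else 0)"
  proof (cases "max a c \<le> min b d")
    case False
    then have "{max a c<..min b d} = {}" by auto
    then show ?thesis using False by (simp only:) simp
  qed simp
  finally show ?thesis using assms by (auto simp: min_def max_def abs_if)
qed

lemma L2_fun_indicator_Ioc: "L2_fun lebesgue (indicator {a<..b::real} :: real \<Rightarrow> real)"
proof -
  have "(\<lambda>x. (indicator {a<..b} x :: real)\<^sup>2) = indicator {a<..b}"
    by (auto simp: indicator_def)
  moreover have "integrable lebesgue (indicator {a<..b} :: real \<Rightarrow> real)"
    by (intro integrable_real_indicator) (cases "a \<le> b"; simp)+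
  ultimately show ?thesis using borel_measurable_integrable by (simp add: L2_fun_def)
qed

text \<open>
  By Levy's uniqueness theorem a variable with this characteristic function is a multiple of
  a standard normal one, so its second moment can be read off. This avoids differentiating the
  characteristic function, which would presuppose that moments exist.
\<close>

lemma (in prob_space) normal_increment_L2:
  assumes [measurable]: "D \<in> borel_measurable M" and v: "v > 0"
    and char: "\<And>u. (LINT \<omega>|M. exp (\<i> * of_real (u * D \<omega>))) = complex_of_real (exp (- v * u\<^sup>2 / 2))"
  shows "L2_fun M D" "(\<integral>\<omega>. (D \<omega>)\<^sup>2 \<partial>M) = v"
proof -
  let ?Z = "\<lambda>\<omega>. D \<omega> / sqrt v"
  have "distr M borel ?Z = std_normal_distribution"
  proof (rule Levy_uniqueness)
    show "real_distribution (distr M borel ?Z)" by (rule real_distribution_distr) measurable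
    show "real_distribution std_normal_distribution" by (rule real_dist_normal_dist)
    show "char (distr M borel ?Z) = char std_normal_distribution"
    proof
      fix u
      have "char (distr M borel ?Z) u = (LINT \<omega>|M. exp (\<i> * of_real ((u / sqrt v) * D \<omega>)))"
        unfolding char_def by (subst integral_distr) simp_all
      also have "\<dots> = exp (- v * (u / sqrt v)\<^sup>2 / 2)" by (rule char)
      also have "- v * (u / sqrt v)\<^sup>2 / 2 = - u\<^sup>2 / 2" using v by (simp add: power_divide)
      finally show "char (distr M borel ?Z) u = char std_normal_distribution u"
        by (simp add: char_std_normal_distribution)
    qed
  qed
  moreover have "(\<integral>x. x\<^sup>2 \<partial>std_normal_distribution) = 1"
    using std_normal_distribution_even_moments(1)[of 1] by simp
  ultimately have int: "integrable (distr M borel ?Z) (\<lambda>x. x\<^sup>2)" and eq: "(\<integral>x. x\<^sup>2 \<partial>distr M borel ?Z) = 1"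
    using integrable_std_normal_distribution_moment[of 2] by simp_all
  have sq: "(D \<omega>)\<^sup>2 = v * (?Z \<omega>)\<^sup>2" for \<omega> using v by (simp add: power_divide)
  have "integrable M (\<lambda>\<omega>. (?Z \<omega>)\<^sup>2)"
    using int by (subst (asm) integrable_distr_eq) simp_all
  then show "L2_fun M D" unfolding L2_fun_def sq by simp
  have "(\<integral>\<omega>. (?Z \<omega>)\<^sup>2 \<partial>M) = 1"
    using eq by (subst (asm) integral_distr) simp_all
  then show "(\<integral>\<omega>. (D \<omega>)\<^sup>2 \<partial>M) = v" unfolding sq by simp
qed


text \<open>
  The second order property of the process on which the construction of the integral rests.
\<close>

locale linear_variance_process = prob_space M for M :: "'a measure" +
  fixes X :: "real \<Rightarrow> 'a \<Rightarrow> real" and v :: real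
  assumes increment_L2: "L2_fun M (\<lambda>\<omega>. X t \<omega> - X s \<omega>)"
    and increment_variance: "(\<integral>\<omega>. (X t \<omega> - X s \<omega>)\<^sup>2 \<partial>M) = v * \<bar>t - s\<bar>"

lemma symmetric_stable_process_2_linear_variance:
  assumes "symmetric_stable_process_2 M X"
  obtains v where "linear_variance_process M X v"
proof -
  from assms obtain c where c: "c > 0"
    and char: "\<And>s t u. (LINT \<omega>|M. exp (\<i> * of_real (u * (X t \<omega> - X s \<omega>)))) =
        complex_of_real (exp (- c * \<bar>t - s\<bar> * \<bar>u\<bar> ^ 2))"
    unfolding symmetric_stable_process_2_def by blast
  interpret prob_space M using assms by (simp add: symmetric_stable_process_2_def)
  have [measurable]: "X t \<in> borel_measurable M" for t
    using assms by (simp add: symmetric_stable_process_2_def)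
  have "L2_fun M (\<lambda>\<omega>. X t \<omega> - X s \<omega>) \<and> (\<integral>\<omega>. (X t \<omega> - X s \<omega>)\<^sup>2 \<partial>M) = 2 * c * \<bar>t - s\<bar>" for s t
  proof (cases "s = t")
    case False
    then have "2 * c * \<bar>t - s\<bar> > 0" using c by simp
    moreover have "(LINT \<omega>|M. exp (\<i> * of_real (u * (X t \<omega> - X s \<omega>)))) =
        complex_of_real (exp (- (2 * c * \<bar>t - s\<bar>) * u\<^sup>2 / 2))" for u
      unfolding char by (simp add: algebra_simps)
    ultimately show ?thesis
      by (intro conjI normal_increment_L2[where v = "2 * c * \<bar>t - s\<bar>"]) measurable
  qed (simp add: L2_fun_zero)
  then have "linear_variance_process M X (2 * c)" by unfold_locales auto
  then show thesis by (rule that)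
qed


section \<open>The isometry between functions and stochastic integrals\<close>

text \<open>
  The Cauchy-Schwarz inequality against the constant function one, which has norm one.
\<close>

lemma (in prob_space) L2_tendsto_imp_converges_in_mean:
  assumes "L2_tendsto M Y Z"
  shows "converges_in_mean M Y Z"
proof -
  have Y: "L2_fun M (Y n)" for n using assms by (simp add: L2_tendsto_def)
  have Z: "L2_fun M Z" and lim: "(\<lambda>n. \<integral>\<omega>. (Y n \<omega> - Z \<omega>)\<^sup>2 \<partial>M) \<longlonglongrightarrow> 0"
    using assms by (auto simp: L2_tendsto_def)
  have one: "L2_fun M (\<lambda>_. 1)" by (simp add: L2_fun_def)
  have int: "integrable M U" if "L2_fun M U" for U
    using L2_fun_integrable_mult[OF that one] by simp
  have le: "(\<integral>\<omega>. norm (Y n \<omega> - Z \<omega>) \<partial>M) \<le> sqrt (\<integral>\<omega>. (Y n \<omega> - Z \<omega>)\<^sup>2 \<partial>M)" for n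
  proof -
    have "L2_fun M (\<lambda>\<omega>. \<bar>Y n \<omega> - Z \<omega>\<bar>)"
      using L2_fun_diff[OF Y[of n] Z] unfolding L2_fun_def
      by (auto simp del: borel_measurable_diff)
    from L2_Cauchy_Schwarz[OF this one] show ?thesis
      by (intro real_le_rsqrt) (simp add: prob_space)
  qed
  have "(\<lambda>n. \<integral>\<omega>. norm (Y n \<omega> - Z \<omega>) \<partial>M) \<longlonglongrightarrow> 0"
  proof (rule tendsto_sandwich[where f = "\<lambda>_. 0"])
    show "(\<lambda>n. sqrt (\<integral>\<omega>. (Y n \<omega> - Z \<omega>)\<^sup>2 \<partial>M)) \<longlonglongrightarrow> 0"
      using tendsto_real_sqrt[OF lim] by simp
  qed (use le in auto)
  then show ?thesis using int Y Z by (simp add: converges_in_mean_def)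
qed

lemma converges_in_mean_unique:
  fixes Y :: "nat \<Rightarrow> 'a \<Rightarrow> real"
  assumes "converges_in_mean M Y Z" "converges_in_mean M Y Z'"
  shows "AE \<omega> in M. Z \<omega> = Z' \<omega>"
proof -
  have int: "integrable M (Y n)" "integrable M Z" "integrable M Z'" for n
    using assms by (auto simp: converges_in_mean_def)
  have "(\<integral>\<omega>. norm (Z \<omega> - Z' \<omega>) \<partial>M) \<le> 0"
  proof (rule tendsto_lowerbound)
    show "(\<lambda>n. (\<integral>\<omega>. norm (Y n \<omega> - Z \<omega>) \<partial>M) + (\<integral>\<omega>. norm (Y n \<omega> - Z' \<omega>) \<partial>M)) \<longlonglongrightarrow> 0"
      using assms by (intro tendsto_add_zero) (auto simp: converges_in_mean_def)
    have "(\<integral>\<omega>. norm (Z \<omega> - Z' \<omega>) \<partial>M)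
        \<le> (\<integral>\<omega>. norm (Y n \<omega> - Z \<omega>) + norm (Y n \<omega> - Z' \<omega>) \<partial>M)" for n
      using int by (intro integral_mono) auto
    then show "\<forall>\<^sub>F n in sequentially. (\<integral>\<omega>. norm (Z \<omega> - Z' \<omega>) \<partial>M)
        \<le> (\<integral>\<omega>. norm (Y n \<omega> - Z \<omega>) \<partial>M) + (\<integral>\<omega>. norm (Y n \<omega> - Z' \<omega>) \<partial>M)"
      using int by simp
  qed simp
  moreover have "(\<integral>\<omega>. norm (Z \<omega> - Z' \<omega>) \<partial>M) \<ge> 0" by simp
  ultimately have "(\<integral>\<omega>. norm (Z \<omega> - Z' \<omega>) \<partial>M) = 0" by linarith
  then have "AE \<omega> in M. norm (Z \<omega> - Z' \<omega>) = 0"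
    using int by (subst (asm) integral_nonneg_eq_0_iff_AE) auto
  then show ?thesis by simp
qed

context linear_variance_process
begin

text \<open>
  Polarization: twice a product of two differences is a signed sum of four squares of
  differences, whose expectations are given by the variance.
\<close>

lemma increment_covariance:
  assumes "a \<le> b" "c \<le> d"
  shows "(\<integral>\<omega>. (X b \<omega> - X a \<omega>) * (X d \<omega> - X c \<omega>) \<partial>M)
    = v * (\<integral>x. indicator {a<..b} x * indicator {c<..d} x \<partial>lebesgue)"
proof -
  have int: "integrable M (\<lambda>\<omega>. (X t \<omega> - X s \<omega>)\<^sup>2)" for s t
    using increment_L2 by (simp add: L2_fun_def)
  have "(\<integral>\<omega>. 2 * ((X b \<omega> - X a \<omega>) * (X d \<omega> - X c \<omega>)) \<partial>M)
      = (\<integral>\<omega>. (X b \<omega> - X c \<omega>)\<^sup>2 + (X a \<omega> - X d \<omega>)\<^sup>2 - (X b \<omega> - X d \<omega>)\<^sup>2 - (X a \<omega> - X c \<omega>)\<^sup>2 \<partial>M)"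
    by (intro Bochner_Integration.integral_cong) (simp_all add: power2_eq_square algebra_simps)
  also have "\<dots> = v * (\<bar>b - c\<bar> + \<bar>a - d\<bar> - \<bar>b - d\<bar> - \<bar>a - c\<bar>)"
    using int by (simp add: increment_variance algebra_simps)
  also have "\<dots> = 2 * (v * (\<integral>x. indicator {a<..b} x * indicator {c<..d} x \<partial>lebesgue))"
    unfolding interval_overlap_length[OF assms, symmetric] by simp
  finally show ?thesis by simp
qed

text \<open>
  The graph of the stochastic integral as an isometry: the smallest closed linear subspace of
  \<open>L\<^sup>2(\<real>) \<times> L\<^sup>2(\<Omega>)\<close> that contains the pairs of an indicator function and the increment over the
  same interval. A relation, because the integral is determined only almost surely; the inductive
  form turns each extension by linearity and continuity into a rule induction.
\<close>

inductive wiener_integral :: "(real \<Rightarrow> real) \<Rightarrow> ('a \<Rightarrow> real) \<Rightarrow> bool" where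
  increment: "a \<le> b \<Longrightarrow> wiener_integral (indicator {a<..b}) (\<lambda>\<omega>. X b \<omega> - X a \<omega>)"
| lincomb: "wiener_integral h J \<Longrightarrow> wiener_integral h' J' \<Longrightarrow>
    wiener_integral (\<lambda>s. h s + c * h' s) (\<lambda>\<omega>. J \<omega> + c * J' \<omega>)"
| limit: "(\<And>n. wiener_integral (h n) (J n)) \<Longrightarrow> L2_tendsto lebesgue h g \<Longrightarrow> L2_tendsto M J I \<Longrightarrow>
    wiener_integral g I"

lemma wiener_integral_L2:
  "wiener_integral h J \<Longrightarrow> L2_fun lebesgue h \<and> L2_fun M J"
  by (induction rule: wiener_integral.induct)
     (auto simp: L2_fun_indicator_Ioc increment_L2 intro: L2_fun_lincomb simp: L2_tendsto_def)

text \<open>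
  The identity of inner products is first proved with one factor being an increment, by
  induction over the other factor; \<open>wiener_integral_inner\<close> then extends it in the first factor.
\<close>

lemma wiener_integral_inner_increment:
  assumes "wiener_integral h J" "a \<le> b"
  shows "(\<integral>\<omega>. J \<omega> * (X b \<omega> - X a \<omega>) \<partial>M) = v * (\<integral>x. h x * indicator {a<..b} x \<partial>lebesgue)"
  using assms(1)
proof induction
  case (increment c d)
  then show ?case using increment_covariance assms(2) by simp
next
  case (lincomb h J h' J' c)
  note L2 = wiener_integral_L2[OF lincomb.hyps(1)] wiener_integral_L2[OF lincomb.hyps(2)]
  have i: "integrable M (\<lambda>\<omega>. J \<omega> * (X b \<omega> - X a \<omega>))" "integrable M (\<lambda>\<omega>. J' \<omega> * (X b \<omega> - X a \<omega>))"
    "integrable lebesgue (\<lambda>x. h x * indicator {a<..b} x)" "integrable lebesgue (\<lambda>x. h' x * indicator {a<..b} x)"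
    using L2 L2_fun_indicator_Ioc increment_L2 by (auto intro!: L2_fun_integrable_mult)
  show ?case using i lincomb.IH
    by (simp only: distrib_right mult.assoc Bochner_Integration.integral_add integrable_mult_right
        integral_mult_right_zero) (simp add: algebra_simps)
next
  case (limit h J g I)
  have "(\<lambda>n. \<integral>\<omega>. J n \<omega> * (X b \<omega> - X a \<omega>) \<partial>M) \<longlonglongrightarrow> (\<integral>\<omega>. I \<omega> * (X b \<omega> - X a \<omega>) \<partial>M)"
    by (intro L2_tendsto_integral_mult limit.hyps increment_L2)
  moreover have "(\<lambda>n. v * (\<integral>x. h n x * indicator {a<..b} x \<partial>lebesgue))
      \<longlonglongrightarrow> v * (\<integral>x. g x * indicator {a<..b} x \<partial>lebesgue)"
    by (intro tendsto_mult_left L2_tendsto_integral_mult limit.hyps L2_fun_indicator_Ioc)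
  ultimately show ?case unfolding limit.IH by (rule LIMSEQ_unique)
qed

lemma wiener_integral_inner:
  assumes "wiener_integral h J" "wiener_integral h' J'"
  shows "(\<integral>\<omega>. J' \<omega> * J \<omega> \<partial>M) = v * (\<integral>x. h' x * h x \<partial>lebesgue)"
  using assms(2)
proof induction
  case (increment c d)
  then show ?case using wiener_integral_inner_increment[OF assms(1)] by (simp add: mult.commute)
next
  case (lincomb h1 J1 h2 J2 c)
  note L2 = wiener_integral_L2[OF lincomb.hyps(1)] wiener_integral_L2[OF lincomb.hyps(2)]
    wiener_integral_L2[OF assms(1)]
  have i: "integrable M (\<lambda>\<omega>. J1 \<omega> * J \<omega>)" "integrable M (\<lambda>\<omega>. J2 \<omega> * J \<omega>)"
    "integrable lebesgue (\<lambda>x. h1 x * h x)" "integrable lebesgue (\<lambda>x. h2 x * h x)"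
    using L2 by (auto intro!: L2_fun_integrable_mult)
  show ?case using i lincomb.IH
    by (simp only: distrib_right mult.assoc Bochner_Integration.integral_add integrable_mult_right
        integral_mult_right_zero) (simp add: algebra_simps)
next
  case (limit h2 J2 g I)
  have "(\<lambda>n. \<integral>\<omega>. J2 n \<omega> * J \<omega> \<partial>M) \<longlonglongrightarrow> (\<integral>\<omega>. I \<omega> * J \<omega> \<partial>M)"
    using wiener_integral_L2[OF assms(1)]
    by (intro L2_tendsto_integral_mult limit.hyps) auto
  moreover have "(\<lambda>n. v * (\<integral>x. h2 n x * h x \<partial>lebesgue)) \<longlonglongrightarrow> v * (\<integral>x. g x * h x \<partial>lebesgue)"
    using wiener_integral_L2[OF assms(1)]
    by (intro tendsto_mult_left L2_tendsto_integral_mult limit.hyps) auto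
  ultimately show ?case unfolding limit.IH by (rule LIMSEQ_unique)
qed

lemma wiener_integral_diff:
  "wiener_integral h J \<Longrightarrow> wiener_integral h' J' \<Longrightarrow>
    wiener_integral (\<lambda>s. h s - h' s) (\<lambda>\<omega>. J \<omega> - J' \<omega>)"
  using lincomb[of h J h' J' "-1"] by simp

lemma wiener_integral_isometry:
  assumes "wiener_integral h J" "wiener_integral h' J'"
  shows "(\<integral>\<omega>. (J \<omega> - J' \<omega>)\<^sup>2 \<partial>M) = v * (\<integral>x. (h x - h' x)\<^sup>2 \<partial>lebesgue)"
  using wiener_integral_inner[OF wiener_integral_diff[OF assms] wiener_integral_diff[OF assms]]
  by (simp add: power2_eq_square)

lemma wiener_integral_zero: "wiener_integral (\<lambda>_. 0) (\<lambda>_. 0)"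
  using increment[of 0 0] by (simp add: indicator_def[abs_def])

lemma wiener_integral_sum:
  assumes "\<And>i. i \<in> A \<Longrightarrow> wiener_integral (h i) (J i)"
  shows "wiener_integral (\<lambda>s. \<Sum>i\<in>A. c i * h i s) (\<lambda>\<omega>. \<Sum>i\<in>A. c i * J i \<omega>)"
  using assms
proof (induction A rule: infinite_finite_induct)
  case (insert i A)
  then have "wiener_integral (\<lambda>s. (\<Sum>i\<in>A. c i * h i s) + c i * h i s)
      (\<lambda>\<omega>. (\<Sum>i\<in>A. c i * J i \<omega>) + c i * J i \<omega>)"
    by (intro lincomb) auto
  then show ?case using insert.hyps by (simp add: add.commute)
qed (simp_all add: wiener_integral_zero)

lemma wiener_integral_tendsto:
  assumes h: "\<And>n. wiener_integral (h n) (J n)" and g: "wiener_integral g I"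
    and lim: "L2_tendsto lebesgue h g"
  shows "L2_tendsto M J I"
proof -
  have "(\<lambda>n. v * (\<integral>x. (h n x - g x)\<^sup>2 \<partial>lebesgue)) \<longlonglongrightarrow> v * 0"
    using lim by (intro tendsto_mult_left) (simp add: L2_tendsto_def)
  then show ?thesis
    using wiener_integral_L2[OF h] wiener_integral_L2[OF g]
    by (simp add: L2_tendsto_def wiener_integral_isometry[OF h g])
qed

lemma variance_rate_nonneg: "v \<ge> 0"
  using increment_variance[of 1 0] Bochner_Integration.integral_nonneg[of M "\<lambda>\<omega>. (X 1 \<omega> - X 0 \<omega>)\<^sup>2"] by simp

text \<open>
  By the isometry, convergence of the integrands makes the integrals a Cauchy sequence.
\<close>

lemma wiener_integral_limit_exists:
  assumes h: "\<And>n. wiener_integral (h n) (J n)" and lim: "L2_tendsto lebesgue h g"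
  shows "\<exists>I. wiener_integral g I"
proof -
  have "\<exists>I. L2_tendsto M J I"
  proof (rule L2_complete)
    show "L2_fun M (J n)" for n using wiener_integral_L2[OF h] by simp
    fix e :: real assume "e > 0"
    \<comment> \<open>Dividing by \<open>v + 1\<close> rather than \<open>v\<close> covers the case \<open>v = 0\<close>.\<close>
    then obtain n0 where n0: "\<And>m n. m \<ge> n0 \<Longrightarrow> n \<ge> n0 \<Longrightarrow>
        (\<integral>x. (h m x - h n x)\<^sup>2 \<partial>lebesgue) < e / (v + 1)"
      using L2_tendsto_Cauchy[OF lim, of "e / (v + 1)"] variance_rate_nonneg by auto
    have "v * (\<integral>x. (h m x - h n x)\<^sup>2 \<partial>lebesgue) < e" if "m \<ge> n0" "n \<ge> n0" for m n
    proof -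
      have "v * (\<integral>x. (h m x - h n x)\<^sup>2 \<partial>lebesgue) \<le> v * (e / (v + 1))"
        using n0[OF that] variance_rate_nonneg by (intro mult_left_mono) auto
      also have "\<dots> < e" using variance_rate_nonneg \<open>e > 0\<close> by (simp add: field_simps)
      finally show ?thesis .
    qed
    then show "\<exists>n0. \<forall>m\<ge>n0. \<forall>n\<ge>n0. (\<integral>\<omega>. (J m \<omega> - J n \<omega>)\<^sup>2 \<partial>M) < e"
      unfolding wiener_integral_isometry[OF h h] by blast
  qed
  then show ?thesis using limit[OF h lim] by blast
qed

text \<open>
  An instance of the closure under limits: at distance zero, a constant sequence converges to
  every version of its value.
\<close>

lemma wiener_integral_AE_cong:
  assumes "wiener_integral h J" "AE \<omega> in M. J \<omega> = I \<omega>" "I \<in> borel_measurable M"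
  shows "wiener_integral h I"
proof -
  have h: "L2_fun lebesgue h" and J: "L2_fun M J" using wiener_integral_L2[OF assms(1)] by auto
  have JI: "L2_fun M (\<lambda>\<omega>. J \<omega> - I \<omega>)" and z: "(\<integral>\<omega>. (J \<omega> - I \<omega>)\<^sup>2 \<partial>M) = 0"
  proof -
    have [measurable]: "J \<in> borel_measurable M" "I \<in> borel_measurable M" using J assms(3) by measurable
    have AE: "AE \<omega> in M. (J \<omega> - I \<omega>)\<^sup>2 = 0" using assms(2) by auto
    then have "integrable M (\<lambda>\<omega>. (J \<omega> - I \<omega>)\<^sup>2) \<longleftrightarrow> integrable M (\<lambda>\<omega>. 0::real)"
      by (intro integrable_cong_AE) auto
    then show "L2_fun M (\<lambda>\<omega>. J \<omega> - I \<omega>)" by (simp add: L2_fun_def)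
    show "(\<integral>\<omega>. (J \<omega> - I \<omega>)\<^sup>2 \<partial>M) = 0" by (rule integral_eq_zero_AE[OF AE])
  qed
  have I: "L2_fun M I" using L2_fun_diff[OF J JI] by simp
  show ?thesis
    by (rule limit[of "\<lambda>_. h" "\<lambda>_. J"]) (use assms(1) h J I z in \<open>auto simp: L2_tendsto_def\<close>)
qed

end

section \<open>Approximation by step functions\<close>

lemma L2_fun_indicator_mult:
  assumes "L2_fun lebesgue h" "S \<in> sets lebesgue"
  shows "L2_fun lebesgue (\<lambda>x. indicator S x * h x)"
  unfolding L2_fun_def
proof
  have [measurable]: "h \<in> borel_measurable lebesgue" using assms(1) by measurable
  note [measurable] = assms(2)
  show "(\<lambda>x. indicator S x * h x) \<in> borel_measurable lebesgue" by measurable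
  show "integrable lebesgue (\<lambda>x. (indicator S x * h x)\<^sup>2)"
  proof (rule Bochner_Integration.integrable_bound)
    show "integrable lebesgue (\<lambda>x. (h x)\<^sup>2)" using assms(1) by (simp add: L2_fun_def)
    show "(\<lambda>x. (indicator S x * h x)\<^sup>2) \<in> borel_measurable lebesgue" by measurable
    show "AE x in lebesgue. norm ((indicator S x * h x)\<^sup>2) \<le> norm ((h x)\<^sup>2)"
      by (auto simp: indicator_def)
  qed
qed

lemma square_integrable_on_real_iff:
  fixes h :: "real \<Rightarrow> real"
  shows "square_integrable_on S h \<longleftrightarrow> L2_fun lebesgue (\<lambda>x. indicator S x * h x)"
proof -
  have "(\<lambda>x. (indicator S x * h x)\<^sup>2) = (\<lambda>x. indicator S x *\<^sub>R (norm (h x))\<^sup>2)"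
    by (auto simp: indicator_def)
  then show ?thesis
    by (simp add: square_integrable_on_def L2_fun_def set_borel_measurable_def set_integrable_def)
qed

text \<open>
  Cutting functions off with indicator functions translates convergence on \<open>S\<close> into
  convergence on the whole line, so that integrals over different intervals live in one space.
\<close>

lemma L2_converges_on_real_iff:
  fixes h :: "real \<Rightarrow> real"
  shows "L2_converges_on S g h \<longleftrightarrow>
    L2_tendsto lebesgue (\<lambda>n x. indicator S x * g n x) (\<lambda>x. indicator S x * h x)"
proof -
  have "(LINT x:S|lebesgue. (norm (g n x - h x))\<^sup>2)
      = (\<integral>x. (indicator S x * g n x - indicator S x * h x)\<^sup>2 \<partial>lebesgue)" for n
    unfolding set_lebesgue_integral_def
    by (intro Bochner_Integration.integral_cong) (auto simp: indicator_def)
  then show ?thesis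
    by (simp add: L2_converges_on_def L2_tendsto_def square_integrable_on_real_iff)
qed

lemma step_partition_bounds:
  fixes \<tau> :: "nat \<Rightarrow> real"
  assumes "\<And>j. j < m \<Longrightarrow> \<tau> j < \<tau> (Suc j)" "j < m"
  shows "\<tau> 0 \<le> \<tau> j" "\<tau> (Suc j) \<le> \<tau> m"
proof -
  have "\<tau> 0 \<le> \<tau> j" if "j \<le> m" for j
    using that
  proof (induction j)
    case (Suc j)
    then show ?case using assms(1)[of j] by auto
  qed simp
  then show "\<tau> 0 \<le> \<tau> j" using assms(2) by simp
  have "\<tau> i \<le> \<tau> m" if "i \<le> m" for i
    using that
  proof (induction rule: inc_induct)
    case (step i)
    then show ?case using assms(1)[of i] by auto
  qed simp
  then show "\<tau> (Suc j) \<le> \<tau> m" using assms(2) by simp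
qed

lemma step_function_outside:
  assumes "step_data_on a b d" "s \<notin> {a..b}"
  shows "step_function d s = 0"
proof -
  obtain m \<tau> c where d: "d = (m, \<tau>, c)" by (cases d)
  have t: "a \<le> \<tau> 0" "\<tau> m \<le> b" and mono: "\<And>j. j < m \<Longrightarrow> \<tau> j < \<tau> (Suc j)"
    using assms(1) by (auto simp: d step_data_on_def)
  have "indicator {\<tau> j<..\<tau> (Suc j)} s = (0::real)" if "j < m" for j
    using step_partition_bounds[of m \<tau> j] mono that t assms(2) by (auto simp: indicator_def)
  then show ?thesis unfolding d step_function_def prod.case by (intro sum.neutral) auto
qed

lemma step_function_Suc:
  "step_function (Suc m, \<tau>, c) s = step_function (m, \<tau>, c) s + c m * indicator {\<tau> m<..\<tau> (Suc m)} s"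
  unfolding step_function_def prod.case by (rule sum.lessThan_Suc)

lemma step_function_value:
  fixes \<tau> :: "nat \<Rightarrow> real"
  assumes "\<And>j. j < m \<Longrightarrow> \<tau> j < \<tau> (Suc j)" "\<tau> 0 < s" "s \<le> \<tau> m"
  shows "\<exists>j<m. \<tau> j < s \<and> s \<le> \<tau> (Suc j) \<and> step_function (m, \<tau>, c) s = c j"
  using assms
proof (induction m)
  case (Suc m)
  show ?case
  proof (cases "s \<le> \<tau> m")
    case True
    with Suc obtain j where j: "j < m" "\<tau> j < s" "s \<le> \<tau> (Suc j)" "step_function (m, \<tau>, c) s = c j"
      by force
    then have "step_function (Suc m, \<tau>, c) s = c j"
      using True by (simp add: step_function_Suc)
    then show ?thesis using j by (intro exI[of _ j]) auto
  next
    case False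
    have "indicator {\<tau> j<..\<tau> (Suc j)} s = (0::real)" if "j < m" for j
      using step_partition_bounds(2)[of m \<tau> j] that Suc.prems(1) False by (auto simp: indicator_def)
    then have "step_function (m, \<tau>, c) s = 0"
      unfolding step_function_def prod.case by (intro sum.neutral) auto
    then have "step_function (Suc m, \<tau>, c) s = c m"
      using False Suc.prems(3) by (simp add: step_function_Suc)
    then show ?thesis using False Suc.prems(3) by (intro exI[of _ m]) auto
  qed
qed simp

lemma L2_fun_step_function: "L2_fun lebesgue (step_function d)"
proof -
  obtain m \<tau> c where d: "d = (m, \<tau>, c)" by (cases d)
  show ?thesis unfolding d step_function_def prod.case
    by (intro L2_fun_sum L2_fun_indicator_Ioc)
qed

lemma step_approximates_iff:
  "step_approximates a b \<phi> h \<longleftrightarrow> (\<forall>n. step_data_on a b (\<phi> n)) \<and>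
    L2_tendsto lebesgue (\<lambda>n. step_function (\<phi> n)) (\<lambda>x. indicator {a..b} x * h x)"
proof (cases "\<forall>n. step_data_on a b (\<phi> n)")
  case True
  then have "indicator {a..b} x * step_function (\<phi> n) x = step_function (\<phi> n) x" for n x
    using step_function_outside[of a b "\<phi> n" x] by (auto simp: indicator_def)
  then have "(\<lambda>n x. indicator {a..b} x * step_function (\<phi> n) x) = (\<lambda>n. step_function (\<phi> n))"
    by (intro ext)
  then show ?thesis using True by (simp add: step_approximates_def L2_converges_on_real_iff)
qed (auto simp: step_approximates_def)

lemma ex_step_approximates:
  assumes h: "L2_fun lebesgue (\<lambda>x. indicator {a..b} x * h x)"
    and ex: "\<And>e. e > 0 \<Longrightarrow> \<exists>d. step_data_on a b d \<and>
      (\<integral>x. (step_function d x - indicator {a..b} x * h x)\<^sup>2 \<partial>lebesgue) < e"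
  shows "\<exists>\<phi>. step_approximates a b \<phi> h"
proof -
  have "\<forall>n. \<exists>d. step_data_on a b d \<and>
      (\<integral>x. (step_function d x - indicator {a..b} x * h x)\<^sup>2 \<partial>lebesgue) < 1 / real (Suc n)"
    using ex by simp
  then obtain \<phi> where \<phi>: "\<And>n. step_data_on a b (\<phi> n)"
      "\<And>n. (\<integral>x. (step_function (\<phi> n) x - indicator {a..b} x * h x)\<^sup>2 \<partial>lebesgue) < 1 / real (Suc n)"
    by metis
  have "(\<lambda>n. \<integral>x. (step_function (\<phi> n) x - indicator {a..b} x * h x)\<^sup>2 \<partial>lebesgue) \<longlonglongrightarrow> 0"
  proof (rule tendsto_sandwich[where f = "\<lambda>_. 0"])
    show "(\<lambda>n. 1 / real (Suc n)) \<longlonglongrightarrow> 0" using LIMSEQ_inverse_real_of_nat by (simp add: inverse_eq_divide)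
    show "\<forall>\<^sub>F n in sequentially.
        (\<integral>x. (step_function (\<phi> n) x - indicator {a..b} x * h x)\<^sup>2 \<partial>lebesgue) \<le> 1 / real (Suc n)"
      by (intro always_eventually allI less_imp_le \<phi>(2))
  qed auto
  then have "step_approximates a b \<phi> h"
    using \<phi>(1) h L2_fun_step_function by (simp add: step_approximates_iff L2_tendsto_def)
  then show ?thesis by blast
qed

lemma ex_step_approximates_L2_limit:
  assumes g: "\<And>n. \<exists>\<phi>. step_approximates a b \<phi> (g n)"
    and lim: "L2_tendsto lebesgue g h"
  shows "\<exists>\<phi>. step_approximates a b \<phi> h"
proof (rule ex_step_approximates)
  let ?r = "\<lambda>f x. indicator {a..b} x * f x :: real"
  have gL: "L2_fun lebesgue (g n)" for n using lim by (simp add: L2_tendsto_def)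
  have hL: "L2_fun lebesgue h" using lim by (simp add: L2_tendsto_def)
  then show rh: "L2_fun lebesgue (?r h)" by (rule L2_fun_indicator_mult) simp
  fix e :: real assume "e > 0"
  then have "\<forall>\<^sub>F n in sequentially. (\<integral>x. (g n x - h x)\<^sup>2 \<partial>lebesgue) < e / 4"
    using lim by (intro order_tendstoD[where y=0]) (auto simp: L2_tendsto_def)
  then obtain n where n: "(\<integral>x. (g n x - h x)\<^sup>2 \<partial>lebesgue) < e / 4"
    by (auto simp: eventually_sequentially)
  have rg: "L2_fun lebesgue (?r (g n))" by (rule L2_fun_indicator_mult[OF gL]) simp
  have le: "(\<integral>x. (?r (g n) x - ?r h x)\<^sup>2 \<partial>lebesgue) \<le> (\<integral>x. (g n x - h x)\<^sup>2 \<partial>lebesgue)"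
    using L2_fun_diff[OF rg rh] L2_fun_diff[OF gL[of n] hL]
    by (intro integral_mono) (auto simp: L2_fun_def indicator_def)
  obtain \<phi> where \<phi>: "step_approximates a b \<phi> (g n)" using g by blast
  then have "\<forall>\<^sub>F k in sequentially. (\<integral>x. (step_function (\<phi> k) x - ?r (g n) x)\<^sup>2 \<partial>lebesgue) < e / 4"
    using \<open>e > 0\<close> by (intro order_tendstoD[where y=0]) (auto simp: L2_tendsto_def step_approximates_iff)
  then obtain k where k: "(\<integral>x. (step_function (\<phi> k) x - ?r (g n) x)\<^sup>2 \<partial>lebesgue) < e / 4"
    by (auto simp: eventually_sequentially)
  have "(\<integral>x. (step_function (\<phi> k) x - ?r h x)\<^sup>2 \<partial>lebesgue) < e"
    using L2_sq_diff_triangle[OF L2_fun_step_function rg rh, of "\<phi> k"] n le k by linarith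
  then show "\<exists>d. step_data_on a b d \<and> (\<integral>x. (step_function d x - ?r h x)\<^sup>2 \<partial>lebesgue) < e"
    using \<phi> by (intro exI[of _ "\<phi> k"]) (simp add: step_approximates_iff)
qed

text \<open>
  A continuous function on a compact interval is uniformly continuous, so its values at the
  left ends of a fine equidistant partition give a step function that is uniformly close on
  \<open>(a, b]\<close>; the point \<open>a\<close>, where step functions vanish, is negligible.
\<close>

lemma ex_step_approximates_continuous:
  assumes "a \<le> b" and cont: "continuous_on {a..b} h"
  shows "\<exists>\<phi>. step_approximates a b \<phi> h"
proof (rule ex_step_approximates)
  let ?r = "\<lambda>x. indicator {a..b} x * h x :: real"
  have m: "?r \<in> borel_measurable lebesgue"
    using borel_measurable_continuous_on_indicator[OF _ cont] by (intro measurable_completion) simp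
  obtain B where B: "\<And>x. x \<in> {a..b} \<Longrightarrow> \<bar>h x\<bar> \<le> B"
  proof -
    have "bounded (h ` {a..b})"
      by (intro compact_imp_bounded compact_continuous_image cont compact_Icc)
    then obtain B where "\<forall>y\<in>h ` {a..b}. \<bar>y\<bar> \<le> B" by (auto simp: bounded_iff)
    then show thesis by (intro that[of B]) auto
  qed
  have int: "integrable lebesgue (\<lambda>x. C * indicator {a..b} x :: real)" for C
    by (intro integrable_mult_right integrable_real_indicator) (use \<open>a \<le> b\<close> in simp_all)
  have "integrable lebesgue (\<lambda>x. (?r x)\<^sup>2)"
  proof (rule Bochner_Integration.integrable_bound[OF int])
    show "(\<lambda>x. (?r x)\<^sup>2) \<in> borel_measurable lebesgue" using m by measurable
    show "AE x in lebesgue. norm ((?r x)\<^sup>2) \<le> norm (B\<^sup>2 * indicator {a..b} x :: real)"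
      using B by (intro AE_I2) (force simp: indicator_def power2_le_iff_abs_le intro: order_trans[OF _ abs_ge_self] abs_le_square_iff[THEN iffD1])
  qed
  then show r: "L2_fun lebesgue ?r" using m by (simp add: L2_fun_def)
  fix e :: real assume e: "e > 0"
  \<comment> \<open>The added \<open>1\<close> keeps the denominator positive for \<open>a = b\<close> and makes the final bound strict.\<close>
  define \<epsilon> where "\<epsilon> = sqrt (e / (b - a + 1))"
  have \<epsilon>: "\<epsilon> > 0" "\<epsilon>\<^sup>2 * (b - a) < e"
    using e \<open>a \<le> b\<close> by (auto simp: \<epsilon>_def field_simps)
  have "uniformly_continuous_on {a..b} h"
    by (rule compact_uniformly_continuous[OF cont compact_Icc])
  then obtain \<delta> where \<delta>: "\<delta> > 0"
      "\<And>x y. x \<in> {a..b} \<Longrightarrow> y \<in> {a..b} \<Longrightarrow> dist x y < \<delta> \<Longrightarrow> dist (h x) (h y) < \<epsilon>"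
    using \<epsilon>(1) unfolding uniformly_continuous_on_def by metis
  have "\<exists>d. step_data_on a b d \<and> (\<forall>x\<in>{a<..b}. \<bar>step_function d x - h x\<bar> \<le> \<epsilon>)"
  proof (cases "a = b")
    case True
    \<comment> \<open>The nodes of a step function must increase strictly, so the degenerate interval needs an empty partition.\<close>
    then show ?thesis
      by (intro exI[of _ "(0, \<lambda>_. a, \<lambda>_. 0)"]) (simp add: step_data_on_def)
  next
    case False
    then have "b - a > 0" using \<open>a \<le> b\<close> by simp
    obtain N :: nat where N: "(b - a) / \<delta> < real N" using reals_Archimedean2 by blast
    then have "N > 0" using \<open>b - a > 0\<close> \<delta>(1) by (intro gr0I) (simp add: divide_less_0_iff not_less)
    define \<tau> where "\<tau> j = a + (b - a) * real j / real N" for j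
    have gap: "\<tau> (Suc j) = \<tau> j + (b - a) / real N" for j
      by (simp add: \<tau>_def distrib_left add_divide_distrib)
    have \<tau>: "\<tau> j < \<tau> (Suc j)" "\<tau> (Suc j) < \<tau> j + \<delta>" for j
      unfolding gap using \<open>N > 0\<close> \<open>b - a > 0\<close> N \<delta>(1) by (auto simp: field_simps)
    have ends: "\<tau> 0 = a" "\<tau> N = b" using \<open>N > 0\<close> by (simp_all add: \<tau>_def)
    have "\<bar>step_function (N, \<tau>, \<lambda>j. h (\<tau> j)) x - h x\<bar> \<le> \<epsilon>" if x: "x \<in> {a<..b}" for x
    proof -
      obtain j where j: "j < N" "\<tau> j < x" "x \<le> \<tau> (Suc j)"
          "step_function (N, \<tau>, \<lambda>j. h (\<tau> j)) x = h (\<tau> j)"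
        using step_function_value[of N \<tau> x "\<lambda>j. h (\<tau> j)"] \<tau>(1) x ends by auto
      have "a \<le> \<tau> j" using step_partition_bounds(1)[of N \<tau> j] \<tau>(1) j(1) ends by simp
      then have "dist (h (\<tau> j)) (h x) < \<epsilon>"
        using x j \<tau>(2)[of j] by (intro \<delta>(2)) (auto simp: dist_real_def)
      then show ?thesis using j(4) by (simp add: dist_real_def)
    qed
    moreover have "step_data_on a b (N, \<tau>, \<lambda>j. h (\<tau> j))"
      using \<tau>(1) ends by (simp add: step_data_on_def)
    ultimately show ?thesis by blast
  qed
  then obtain d where d: "step_data_on a b d"
      and near: "\<And>x. x \<in> {a<..b} \<Longrightarrow> \<bar>step_function d x - h x\<bar> \<le> \<epsilon>" by blast
  have "(\<integral>x. (step_function d x - ?r x)\<^sup>2 \<partial>lebesgue) \<le> (\<integral>x. \<epsilon>\<^sup>2 * indicator {a..b} x \<partial>lebesgue)"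
  proof (rule integral_mono_AE)
    show "integrable lebesgue (\<lambda>x. (step_function d x - ?r x)\<^sup>2)"
      using L2_fun_diff[OF L2_fun_step_function r, of d] by (simp add: L2_fun_def)
    have "AE x in lebesgue. x \<noteq> a"
      by (intro AE_completion AE_lborel_singleton)
    then show "AE x in lebesgue. (step_function d x - ?r x)\<^sup>2 \<le> \<epsilon>\<^sup>2 * indicator {a..b} x"
    proof eventually_elim
      case (elim x)
      show ?case
      proof (cases "x \<in> {a..b}")
        case True
        then have "\<bar>step_function d x - h x\<bar> \<le> \<bar>\<epsilon>\<bar>" using near[of x] elim \<epsilon>(1) by auto
        then show ?thesis using True by (simp add: abs_le_square_iff)
      qed (simp add: step_function_outside[OF d])
    qed
  qed (rule int)
  also have "\<dots> < e" using \<epsilon>(2) \<open>a \<le> b\<close> by simp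
  finally show "\<exists>d. step_data_on a b d \<and> (\<integral>x. (step_function d x - ?r x)\<^sup>2 \<partial>lebesgue) < e"
    using d by blast
qed

lemma L2_tendsto_restrict_intervals:
  assumes h: "L2_fun lebesgue h"
  shows "L2_tendsto lebesgue (\<lambda>n x. indicator {- real n..real n} x * h x) h"
proof -
  let ?r = "\<lambda>n x. indicator {- real n..real n} x * h x"
  have r: "L2_fun lebesgue (?r n)" for n by (rule L2_fun_indicator_mult[OF h]) simp
  have "(\<lambda>n. \<integral>x. (?r n x - h x)\<^sup>2 \<partial>lebesgue) \<longlonglongrightarrow> (\<integral>x. 0 \<partial>(lebesgue :: real measure))"
  proof (rule integral_dominated_convergence)
    show "integrable lebesgue (\<lambda>x. (h x)\<^sup>2)" using h by (simp add: L2_fun_def)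
    show "(\<lambda>x. (?r n x - h x)\<^sup>2) \<in> borel_measurable lebesgue" for n
      by (intro borel_measurable_power L2_fun_measurable L2_fun_diff r h)
    show "AE x in lebesgue. norm ((?r n x - h x)\<^sup>2) \<le> (h x)\<^sup>2" for n
      by (auto simp: indicator_def)
    show "AE x in lebesgue. (\<lambda>n. (?r n x - h x)\<^sup>2) \<longlonglongrightarrow> 0"
    proof (rule AE_I2)
      fix x
      obtain N :: nat where "\<bar>x\<bar> \<le> real N" using real_arch_simple by blast
      then have "\<forall>\<^sub>F n in sequentially. (?r n x - h x)\<^sup>2 = 0"
        by (intro eventually_sequentiallyI[of N]) (auto simp: indicator_def)
      then show "(\<lambda>n. (?r n x - h x)\<^sup>2) \<longlonglongrightarrow> 0" by (rule tendsto_eventually)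
    qed
  qed simp
  then show ?thesis using r h by (simp add: L2_tendsto_def)
qed

text \<open>
  The integrands for which the stochastic integral over \<open>\<real>\<close> is constructed below. Continuous
  functions and \<open>L\<^sup>2\<close> limits suffice to reach everything in the span of the Hermite functions.
\<close>

definition step_approximable :: "(real \<Rightarrow> real) \<Rightarrow> bool" where
  "step_approximable h \<longleftrightarrow> L2_fun lebesgue h \<and>
     (\<forall>n. \<exists>\<phi>. step_approximates (- real n) (real n) \<phi> h)"

lemma step_approximable_continuous:
  "L2_fun lebesgue h \<Longrightarrow> continuous_on UNIV h \<Longrightarrow> step_approximable h"
  by (auto simp: step_approximable_def intro!: ex_step_approximates_continuous
      intro: continuous_on_subset)

lemma step_approximable_L2_limit:
  "(\<And>n. step_approximable (g n)) \<Longrightarrow> L2_tendsto lebesgue g h \<Longrightarrow> step_approximable h"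
  by (auto simp: step_approximable_def L2_tendsto_def[of lebesgue g h]
      intro!: ex_step_approximates_L2_limit[of _ _ g h])


section \<open>Identification with the limit of step function integrals\<close>

context linear_variance_process
begin

lemma wiener_integral_step:
  assumes "step_data_on a b d"
  shows "wiener_integral (step_function d) (step_stoch_integral X d)"
proof -
  obtain m \<tau> c where d: "d = (m, \<tau>, c)" by (cases d)
  have "\<tau> j \<le> \<tau> (Suc j)" if "j < m" for j
    using assms that by (auto simp: d step_data_on_def intro: less_imp_le)
  then show ?thesis
    unfolding d step_function_def step_stoch_integral_def prod.case
    by (intro wiener_integral_sum increment) auto
qed

text \<open>
  By the isometry the integrals along every approximating sequence have the same limit.
\<close>

lemma has_stoch_integral_on_wiener_integral:
  assumes J: "wiener_integral (\<lambda>x. indicator {a..b} x * h x) J"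
    and ex: "\<exists>\<phi>. step_approximates a b \<phi> h"
  shows "has_stoch_integral_on M X a b h J"
  unfolding has_stoch_integral_on_def
proof (intro conjI allI impI ex)
  fix \<phi> assume "step_approximates a b \<phi> h"
  then show "converges_in_mean M (\<lambda>n. step_stoch_integral X (\<phi> n)) J"
    unfolding step_approximates_iff
    by (intro L2_tendsto_imp_converges_in_mean wiener_integral_tendsto[OF wiener_integral_step J]) auto
qed

lemma wiener_integral_on_exists:
  assumes "\<exists>\<phi>. step_approximates a b \<phi> h"
  shows "\<exists>J. wiener_integral (\<lambda>x. indicator {a..b} x * h x) J"
proof -
  from assms obtain \<phi> where "\<And>n. step_data_on a b (\<phi> n)"
      "L2_tendsto lebesgue (\<lambda>n. step_function (\<phi> n)) (\<lambda>x. indicator {a..b} x * h x)"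
    by (auto simp: step_approximates_iff)
  then show ?thesis by (intro wiener_integral_limit_exists[OF wiener_integral_step])
qed

text \<open>
  The restrictions to \<open>[-n, n]\<close> converge to the integrand in \<open>L\<^sup>2(\<real>)\<close>, and so do their
  integrals in \<open>L\<^sup>2(\<Omega>)\<close>.
\<close>

lemma wiener_integral_has_stoch_integral:
  assumes h: "step_approximable h"
  obtains I where "wiener_integral h I" "has_stoch_integral M X h I"
proof -
  let ?r = "\<lambda>n x. indicator {- real n..real n} x * h x"
  have ap: "\<exists>\<phi>. step_approximates (- real n) (real n) \<phi> h" for n
    using h by (simp add: step_approximable_def)
  have lim: "L2_tendsto lebesgue ?r h"
    using h by (intro L2_tendsto_restrict_intervals) (simp add: step_approximable_def)
  obtain J where J: "\<And>n. wiener_integral (?r n) (J n)"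
    using wiener_integral_on_exists[OF ap] by metis
  obtain I where I: "wiener_integral h I"
    using wiener_integral_limit_exists[OF J lim] by blast
  have "has_stoch_integral M X h I"
    unfolding has_stoch_integral_def
    by (intro exI[of _ J] conjI allI has_stoch_integral_on_wiener_integral J ap
        L2_tendsto_imp_converges_in_mean wiener_integral_tendsto[OF J I lim])
  with I show thesis by (rule that)
qed

text \<open>
  Two integrals may come with different versions of the integrals over \<open>[-n, n]\<close>; these agree
  almost surely for each \<open>n\<close>, hence have the same limit in the mean.
\<close>

lemma has_stoch_integral_unique:
  assumes "has_stoch_integral M X h I" "has_stoch_integral M X h I'"
  shows "AE \<omega> in M. I \<omega> = I' \<omega>"
proof -
  obtain J J' where J: "\<And>n. has_stoch_integral_on M X (- real n) (real n) h (J n)" "converges_in_mean M J I"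
    and J': "\<And>n. has_stoch_integral_on M X (- real n) (real n) h (J' n)" "converges_in_mean M J' I'"
    using assms unfolding has_stoch_integral_def by blast
  have eq: "AE \<omega> in M. J n \<omega> = J' n \<omega>" for n
    using J(1)[of n] J'(1)[of n] unfolding has_stoch_integral_on_def
    by (blast intro: converges_in_mean_unique)
  have "(\<integral>\<omega>. norm (J n \<omega> - I' \<omega>) \<partial>M) = (\<integral>\<omega>. norm (J' n \<omega> - I' \<omega>) \<partial>M)" for n
  proof (rule integral_cong_AE)
    show "(\<lambda>\<omega>. norm (J n \<omega> - I' \<omega>)) \<in> borel_measurable M"
      "(\<lambda>\<omega>. norm (J' n \<omega> - I' \<omega>)) \<in> borel_measurable M"
      using J(2) J'(2) unfolding converges_in_mean_def
      by (auto intro!: borel_measurable_norm borel_measurable_diff borel_measurable_integrable)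
    show "AE \<omega> in M. norm (J n \<omega> - I' \<omega>) = norm (J' n \<omega> - I' \<omega>)" using eq[of n] by auto
  qed
  then have "converges_in_mean M J I'"
    using J(2) J'(2) by (simp add: converges_in_mean_def)
  with J(2) show ?thesis by (rule converges_in_mean_unique)
qed

text \<open>
  The version of the integral that is picked by choice lies in the graph, because all versions
  agree almost surely. From here on the isometry applies to \<open>stoch_integral\<close> itself.
\<close>

lemma stoch_integral_wiener_integral:
  assumes "step_approximable h"
  shows "stoch_integrable M X h" "wiener_integral h (stoch_integral M X h)"
proof -
  obtain I where I: "wiener_integral h I" "has_stoch_integral M X h I"
    using wiener_integral_has_stoch_integral[OF assms] .
  then show "stoch_integrable M X h" by (auto simp: stoch_integrable_def)
  have S: "has_stoch_integral M X h (stoch_integral M X h)"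
    unfolding stoch_integral_def using I(2) by (rule someI[where P = "has_stoch_integral M X h"])
  show "wiener_integral h (stoch_integral M X h)"
  proof (rule wiener_integral_AE_cong[OF I(1) has_stoch_integral_unique[OF I(2) S]])
    show "stoch_integral M X h \<in> borel_measurable M"
      using S by (auto simp: has_stoch_integral_def converges_in_mean_def)
  qed
qed

end

section \<open>The Fourier transform of the kernel\<close>

lemma square_integrable_on_complex_iff:
  fixes F :: "real \<Rightarrow> complex"
  shows "square_integrable_on UNIV F \<longleftrightarrow>
    L2_fun lebesgue (\<lambda>x. Re (F x)) \<and> L2_fun lebesgue (\<lambda>x. Im (F x))"
proof -
  have meas: "F \<in> borel_measurable lebesgue \<longleftrightarrow>
      (\<lambda>x. Re (F x)) \<in> borel_measurable lebesgue \<and> (\<lambda>x. Im (F x)) \<in> borel_measurable lebesgue"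
    by (rule borel_measurable_complex_iff)
  have le: "integrable lebesgue (\<lambda>x. (Re (F x))\<^sup>2)" "integrable lebesgue (\<lambda>x. (Im (F x))\<^sup>2)"
    if "F \<in> borel_measurable lebesgue" "integrable lebesgue (\<lambda>x. (cmod (F x))\<^sup>2)"
  proof -
    have [measurable]: "(\<lambda>x. Re (F x)) \<in> borel_measurable lebesgue"
        "(\<lambda>x. Im (F x)) \<in> borel_measurable lebesgue"
      using that(1) meas by auto
    show "integrable lebesgue (\<lambda>x. (Re (F x))\<^sup>2)"
      by (rule Bochner_Integration.integrable_bound[OF that(2)]) (measurable, simp add: cmod_power2)
    show "integrable lebesgue (\<lambda>x. (Im (F x))\<^sup>2)"
      by (rule Bochner_Integration.integrable_bound[OF that(2)]) (measurable, simp add: cmod_power2)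
  qed
  show ?thesis
    unfolding square_integrable_on_def set_borel_measurable_def set_integrable_def L2_fun_def
    using meas le by (auto simp: cmod_power2)
qed

lemma L2_converges_on_complex_iff:
  fixes F :: "real \<Rightarrow> complex"
  shows "L2_converges_on UNIV G F \<longleftrightarrow>
    L2_tendsto lebesgue (\<lambda>n x. Re (G n x)) (\<lambda>x. Re (F x)) \<and>
    L2_tendsto lebesgue (\<lambda>n x. Im (G n x)) (\<lambda>x. Im (F x))"
proof (cases "(\<forall>n. square_integrable_on UNIV (G n)) \<and> square_integrable_on UNIV F")
  case True
  let ?R = "\<lambda>n. \<integral>x. (Re (G n x) - Re (F x))\<^sup>2 \<partial>lebesgue"
  let ?I = "\<lambda>n. \<integral>x. (Im (G n x) - Im (F x))\<^sup>2 \<partial>lebesgue"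
  have L2: "L2_fun lebesgue (\<lambda>x. Re (G n x))" "L2_fun lebesgue (\<lambda>x. Im (G n x))"
      "L2_fun lebesgue (\<lambda>x. Re (F x))" "L2_fun lebesgue (\<lambda>x. Im (F x))" for n
    using True by (auto simp: square_integrable_on_complex_iff)
  have "integrable lebesgue (\<lambda>x. (Re (G n x) - Re (F x))\<^sup>2)"
      "integrable lebesgue (\<lambda>x. (Im (G n x) - Im (F x))\<^sup>2)" for n
    using L2_fun_diff[OF L2(1,3)] L2_fun_diff[OF L2(2,4)] by (auto simp: L2_fun_def)
  then have eq: "(LINT x:UNIV|lebesgue. (norm (G n x - F x))\<^sup>2) = ?R n + ?I n" for n
    by (simp add: set_lebesgue_integral_def cmod_power2)
  have "(\<lambda>n. ?R n + ?I n) \<longlonglongrightarrow> 0 \<longleftrightarrow> ?R \<longlonglongrightarrow> 0 \<and> ?I \<longlonglongrightarrow> 0"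
  proof (intro iffI conjI)
    assume s: "(\<lambda>n. ?R n + ?I n) \<longlonglongrightarrow> 0"
    show "?R \<longlonglongrightarrow> 0" by (rule tendsto_sandwich[OF _ _ tendsto_const s]) auto
    show "?I \<longlonglongrightarrow> 0" by (rule tendsto_sandwich[OF _ _ tendsto_const s]) auto
  qed (auto intro: tendsto_add_zero)
  then show ?thesis using True L2 unfolding L2_converges_on_def L2_tendsto_def eq by simp
next
  case False
  then show ?thesis by (auto simp: L2_converges_on_def L2_tendsto_def square_integrable_on_complex_iff)
qed

lemma norm_fourier_eigenvalue: "norm (fourier_eigenvalue k) = 1"
  by (simp add: fourier_eigenvalue_def)

lemma hermite_coeff_square_summable:
  assumes "square_integrable_on UNIV f"
  shows "summable (\<lambda>k. (norm (hermite_coeff f k))\<^sup>2)"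
proof -
  have L2: "L2_fun lebesgue (\<lambda>x. Re (f x))" "L2_fun lebesgue (\<lambda>x. Im (f x))"
    using assms by (auto simp: square_integrable_on_complex_iff)
  have int: "integrable lebesgue (\<lambda>t. f t * of_real (hermite_psi k t))" for k
  proof -
    have "integrable lebesgue (\<lambda>t. of_real (Re (f t) * hermite_psi k t)
        + \<i> * of_real (Im (f t) * hermite_psi k t) :: complex)"
      by (intro Bochner_Integration.integrable_add integrable_mult_right integrable_of_real
          L2_fun_integrable_mult L2 L2_fun_hermite_psi)
    also have "(\<lambda>t. of_real (Re (f t) * hermite_psi k t) + \<i> * of_real (Im (f t) * hermite_psi k t))
        = (\<lambda>t. f t * of_real (hermite_psi k t))"
      by (simp add: fun_eq_iff complex_eq_iff)
    finally show ?thesis .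
  qed
  have Re: "Re (hermite_coeff f k) = (\<integral>x. Re (f x) * hermite_psi k x \<partial>lebesgue)"
    and Im: "Im (hermite_coeff f k) = (\<integral>x. Im (f x) * hermite_psi k x \<partial>lebesgue)" for k
    unfolding hermite_coeff_def using int[of k] by (simp_all flip: integral_Re integral_Im)
  show ?thesis
    unfolding cmod_power2 Re Im
    by (intro summable_add L2_Bessel L2_fun_hermite_psi hermite_psi_orthonormal L2)
qed

text \<open>
  The coefficient of \<open>\<psi>\<^sub>k(s)\<close> in the transformed kernel at fixed \<open>t\<close>.
\<close>

definition kernel_coeff :: "(real \<Rightarrow> complex) \<Rightarrow> real \<Rightarrow> nat \<Rightarrow> complex" where
  "kernel_coeff f t k = hermite_coeff f k * fourier_eigenvalue k * of_real (hermite_psi k t)"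

lemma kernel_coeff_square_summable:
  assumes "square_integrable_on UNIV f"
  shows "summable (\<lambda>k. (Re (kernel_coeff f t k))\<^sup>2)" "summable (\<lambda>k. (Im (kernel_coeff f t k))\<^sup>2)"
proof -
  obtain B where B: "\<And>k. (hermite_psi k t)\<^sup>2 \<le> B" using hermite_psi_bounded by blast
  have s: "summable (\<lambda>k. (norm (kernel_coeff f t k))\<^sup>2)"
  proof (rule summable_comparison_test')
    show "summable (\<lambda>k. (norm (hermite_coeff f k))\<^sup>2 * B)"
      by (intro summable_mult2 hermite_coeff_square_summable assms)
    show "norm ((norm (kernel_coeff f t k))\<^sup>2) \<le> (norm (hermite_coeff f k))\<^sup>2 * B" for k
      using B[of k] by (simp add: kernel_coeff_def norm_mult norm_fourier_eigenvalue power_mult_distrib mult_left_mono)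
  qed
  show "summable (\<lambda>k. (Re (kernel_coeff f t k))\<^sup>2)" "summable (\<lambda>k. (Im (kernel_coeff f t k))\<^sup>2)"
    by (rule summable_comparison_test'[OF s]; simp add: cmod_power2)+
qed

lemma kernel_fourier_transform_iff:
  "is_kernel_fourier_transform f t F \<longleftrightarrow>
    L2_tendsto lebesgue (\<lambda>n s. \<Sum>k<n. Re (kernel_coeff f t k) * hermite_psi k s) (\<lambda>s. Re (F s)) \<and>
    L2_tendsto lebesgue (\<lambda>n s. \<Sum>k<n. Im (kernel_coeff f t k) * hermite_psi k s) (\<lambda>s. Im (F s))"
proof -
  have "(\<Sum>k<n. hermite_coeff f k * fourier_eigenvalue k * of_real (hermite_psi k s) * of_real (hermite_psi k t))
      = (\<Sum>k<n. kernel_coeff f t k * of_real (hermite_psi k s))" for n s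
    by (simp add: kernel_coeff_def mult_ac)
  then show ?thesis
    by (simp add: is_kernel_fourier_transform_def L2_converges_on_complex_iff)
qed

lemma kernel_fourier_transform_exists:
  assumes "square_integrable_on UNIV f"
  shows "\<exists>F. is_kernel_fourier_transform f t F"
proof -
  note series = L2_orthonormal_series_converges[OF L2_fun_hermite_psi hermite_psi_orthonormal]
  obtain g where "L2_tendsto lebesgue (\<lambda>n s. \<Sum>k<n. Re (kernel_coeff f t k) * hermite_psi k s) g"
    using series[OF kernel_coeff_square_summable(1)[OF assms]] by blast
  moreover obtain h where "L2_tendsto lebesgue (\<lambda>n s. \<Sum>k<n. Im (kernel_coeff f t k) * hermite_psi k s) h"
    using series[OF kernel_coeff_square_summable(2)[OF assms]] by blast
  ultimately have "is_kernel_fourier_transform f t (\<lambda>s. Complex (g s) (h s))"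
    by (simp add: kernel_fourier_transform_iff)
  then show ?thesis by blast
qed


section \<open>Integration of the series\<close>

lemma converges_in_mean_complex:
  assumes "converges_in_mean M Y Z" "converges_in_mean M Y' Z'"
  shows "converges_in_mean M (\<lambda>n \<omega>. of_real (Y n \<omega>) + \<i> * of_real (Y' n \<omega>) :: complex)
    (\<lambda>\<omega>. of_real (Z \<omega>) + \<i> * of_real (Z' \<omega>))"
proof -
  have int: "integrable M (Y n)" "integrable M Z" "integrable M (Y' n)" "integrable M Z'" for n
    using assms by (auto simp: converges_in_mean_def)
  let ?D = "\<lambda>n \<omega>. (of_real (Y n \<omega>) + \<i> * of_real (Y' n \<omega>)) - (of_real (Z \<omega>) + \<i> * of_real (Z' \<omega>)) :: complex"
  have bound: "(\<integral>\<omega>. norm (?D n \<omega>) \<partial>M)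
      \<le> (\<integral>\<omega>. norm (Y n \<omega> - Z \<omega>) \<partial>M) + (\<integral>\<omega>. norm (Y' n \<omega> - Z' \<omega>) \<partial>M)" for n
  proof -
    have "norm (?D n \<omega>) \<le> norm (Y n \<omega> - Z \<omega>) + norm (Y' n \<omega> - Z' \<omega>)" for \<omega>
      using cmod_le[of "?D n \<omega>"] by simp
    then have "(\<integral>\<omega>. norm (?D n \<omega>) \<partial>M) \<le> (\<integral>\<omega>. norm (Y n \<omega> - Z \<omega>) + norm (Y' n \<omega> - Z' \<omega>) \<partial>M)"
      using int by (intro integral_mono integrable_norm Bochner_Integration.integrable_diff
          Bochner_Integration.integrable_add integrable_of_real integrable_mult_right) auto
    then show ?thesis using int by simp
  qed
  have "(\<lambda>n. \<integral>\<omega>. norm (?D n \<omega>) \<partial>M) \<longlonglongrightarrow> 0"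
  proof (rule tendsto_sandwich[where f = "\<lambda>_. 0"])
    show "(\<lambda>n. (\<integral>\<omega>. norm (Y n \<omega> - Z \<omega>) \<partial>M) + (\<integral>\<omega>. norm (Y' n \<omega> - Z' \<omega>) \<partial>M)) \<longlonglongrightarrow> 0"
      using assms by (intro tendsto_add_zero) (auto simp: converges_in_mean_def)
  qed (use bound in auto)
  then show ?thesis using int by (simp add: converges_in_mean_def)
qed

lemma step_approximable_hermite_psi: "step_approximable (hermite_psi k)"
  by (intro step_approximable_continuous L2_fun_hermite_psi continuous_hermite_psi)

text \<open>
  The heart of the matter for real coefficients: the isometry transports the convergence of the
  series of functions to the series of their integrals.
\<close>

lemma (in linear_variance_process) hermite_series_stoch_integral:
  fixes c :: "nat \<Rightarrow> real"
  assumes lim: "L2_tendsto lebesgue (\<lambda>n s. \<Sum>k<n. c k * hermite_psi k s) g"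
  shows "stoch_integrable M X g"
    and "converges_in_mean M (\<lambda>n \<omega>. \<Sum>k<n. c k * stoch_integral M X (hermite_psi k) \<omega>)
      (stoch_integral M X g)"
proof -
  have "step_approximable (\<lambda>s. \<Sum>k<n. c k * hermite_psi k s)" for n
    by (intro step_approximable_continuous L2_fun_sum L2_fun_hermite_psi continuous_intros
        continuous_hermite_psi)
  then have g: "step_approximable g" by (rule step_approximable_L2_limit[OF _ lim])
  then show "stoch_integrable M X g" by (rule stoch_integral_wiener_integral)
  have "wiener_integral (\<lambda>s. \<Sum>k<n. c k * hermite_psi k s)
      (\<lambda>\<omega>. \<Sum>k<n. c k * stoch_integral M X (hermite_psi k) \<omega>)" for n
    by (intro wiener_integral_sum stoch_integral_wiener_integral step_approximable_hermite_psi)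
  then show "converges_in_mean M (\<lambda>n \<omega>. \<Sum>k<n. c k * stoch_integral M X (hermite_psi k) \<omega>)
      (stoch_integral M X g)"
    by (intro L2_tendsto_imp_converges_in_mean
        wiener_integral_tendsto[OF _ stoch_integral_wiener_integral(2)[OF g] lim])
qed

theorem theorem12:
  fixes M :: "'a measure" and X :: "real \<Rightarrow> 'a \<Rightarrow> real" and f :: "real \<Rightarrow> complex"
  assumes "symmetric_stable_process_2 M X"
    and "integrable lebesgue f"
    and "square_integrable_on UNIV f"
  shows "(\<forall>k. stoch_integrable M X (hermite_psi k)) \<and>
    (\<forall>t.
      (\<exists>F. is_kernel_fourier_transform f t F) \<and>
      (\<forall>F. is_kernel_fourier_transform f t F \<longrightarrow>
         complex_stoch_integrable M X F \<and>
         converges_in_mean M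
           (\<lambda>n \<omega>. \<Sum>k<n. hermite_coeff f k * fourier_eigenvalue k *
                     of_real (stoch_integral M X (hermite_psi k) \<omega>) * of_real (hermite_psi k t))
           (complex_stoch_integral M X F)))"
proof -
  obtain v where "linear_variance_process M X v"
    using symmetric_stable_process_2_linear_variance[OF assms(1)] .
  then interpret linear_variance_process M X v .
  have series: "complex_stoch_integrable M X F \<and>
      converges_in_mean M
        (\<lambda>n \<omega>. \<Sum>k<n. hermite_coeff f k * fourier_eigenvalue k *
                  of_real (stoch_integral M X (hermite_psi k) \<omega>) * of_real (hermite_psi k t))
        (complex_stoch_integral M X F)"
    if "is_kernel_fourier_transform f t F" for t F
  proof -
    let ?A = "\<lambda>k. stoch_integral M X (hermite_psi k)"
    have lims: "L2_tendsto lebesgue (\<lambda>n s. \<Sum>k<n. Re (kernel_coeff f t k) * hermite_psi k s) (\<lambda>s. Re (F s))"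
      "L2_tendsto lebesgue (\<lambda>n s. \<Sum>k<n. Im (kernel_coeff f t k) * hermite_psi k s) (\<lambda>s. Im (F s))"
      using that by (simp_all add: kernel_fourier_transform_iff)
    have "hermite_coeff f k * fourier_eigenvalue k * of_real (?A k \<omega>) * of_real (hermite_psi k t)
        = of_real (Re (kernel_coeff f t k) * ?A k \<omega>) + \<i> * of_real (Im (kernel_coeff f t k) * ?A k \<omega>)"
      for k \<omega>
    proof -
      have "hermite_coeff f k * fourier_eigenvalue k * of_real (?A k \<omega>) * of_real (hermite_psi k t)
          = kernel_coeff f t k * of_real (?A k \<omega>)"
        by (simp add: kernel_coeff_def mult_ac)
      then show ?thesis by (simp add: complex_eq_iff)
    qed
    then have eq: "(\<lambda>n \<omega>. \<Sum>k<n. hermite_coeff f k * fourier_eigenvalue k * of_real (?A k \<omega>) * of_real (hermite_psi k t))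
        = (\<lambda>n \<omega>. of_real (\<Sum>k<n. Re (kernel_coeff f t k) * ?A k \<omega>)
            + \<i> * of_real (\<Sum>k<n. Im (kernel_coeff f t k) * ?A k \<omega>))"
      by (simp add: sum.distrib sum_distrib_left)
    show ?thesis
      unfolding eq complex_stoch_integral_def[abs_def] complex_stoch_integrable_def
      by (intro conjI converges_in_mean_complex hermite_series_stoch_integral[OF lims(1)]
          hermite_series_stoch_integral[OF lims(2)])
  qed
  show ?thesis
    using stoch_integral_wiener_integral(1)[OF step_approximable_hermite_psi]
      kernel_fourier_transform_exists[OF assms(3)] series by blast
qed

end
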